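(* Let $f=\frac1m\sum_{i=1}^mf_i:\mathbb R^d\to\mathbb R$ be a standard self-concordant function, and suppose $f$ is twice continuously differentiable and there are constants $L\ge\lambda>0$ with $\lambda I\preceq f''(w)\preceq LI$ for all $w\in\mathbb R^d$. Let $w_\star$ be the minimizer of $f$. Suppose the input parameter $\mu$ in the DiSCO algorithm (see context) is an upper bound on $\|f_1''(w_k)-f''(w_k)\|_2$ for all $k\ge0$. Then for any $\epsilon>0$, in order to find a solution $\widehat w$ satisfying $f(\widehat w)-f(w_\star)<\epsilon$, the total number of communication rounds $T$ is bounded by $$T\le 1+\left(\left\lceil\frac{f(w_0)-f(w_\star)}{\frac12\omega(1/6)}\right\rceil+\left\lceil\log_2\Bigl(\frac{2\,\omega(1/6)}{\epsilon}\Bigr)\right\rceil\right)\left(2+\sqrt{1+\frac{2\mu}{\lambda}}\,\log\Bigl(\frac{2L}{\beta\lambda}\Bigr)\right),$$ where $\beta=1/20$, $\omega(t)=t-\log(1+t)$, and $\lceil t\rceil$ denotes the smallest nonnegative integer that is larger than or equal to $t$. Ignoring logarithmic terms and universal constants, the number of rounds of communication $T$ is bounded by $$\widetilde{\mathcal O}\Bigl(\bigl(f(w_0)-f(w_\star)+\log(1/\epsilon)\bigr)\sqrt{1+2\mu/\lambda}\Bigr).$$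
   Context: A convex function $f:\mathbb R^d\to\mathbb R$ with continuous third derivatives is standard self-concordant if $|u^T(f'''(w)[u])u|\le 2(u^Tf''(w)u)^{3/2}$ for all $w,u\in\mathbb R^d$, where $f'''(w)[u]=\lim_{t\to0}\frac1t(f''(w+tu)-f''(w))$. $\|\cdot\|_2$ is the Euclidean norm of vectors and the spectral norm of matrices. Setting: there are $m$ machines; the convex function $f_i:\mathbb R^d\to\mathbb R$ can be evaluated only locally at machine $i$; machine 1 is the master. In one round of communication the master broadcasts a message of $O(d)$ bits to all machines, and every machine processes the message and sends a message of $O(d)$ bits back to the master, where these are aggregated (summed or averaged). DiSCO algorithm. Input: parameters $\rho,\mu\ge0$ and precision $\epsilon>0$. Initialization (one round): $w_0=\frac1m\sum_{i=1}^m\widehat w_i$ with $\widehat w_i=\arg\min_w\{f_i(w)+\frac\rho2\|w\|_2^2\}$. Repeat for $k=0,1,2,\dots$: (1) run distributed PCG (below), given $w_k$ and $\mu$, to compute $v_k$ and $\delta_k$; (2) update $w_{k+1}=w_k-\frac1{1+\delta_k}v_k$; until $\delta_k\le(1-\beta)\sqrt\epsilon$. Output $\widehat w=w_{k+1}$. Distributed PCG at $w_k$: let $H=f''(w_k)$, $P=f_1''(w_k)+\mu I$, $\epsilon_k=\beta(\lambda/L)^{1/2}\|f'(w_k)\|_2$ with $\beta=1/20$. One round of communication forms $f'(w_k)=\frac1m\sum_if_i'(w_k)$. Set $v^{(0)}=0$, $r^{(0)}=f'(w_k)$, $s^{(0)}=P^{-1}r^{(0)}$, $u^{(0)}=s^{(0)}$.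 Repeat for $t=0,1,2,\dots$, each iteration using one round (to form $Hu^{(t)}$ and $Hv^{(t)}$): $\alpha_t=\frac{\langle r^{(t)},s^{(t)}\rangle}{\langle u^{(t)},Hu^{(t)}\rangle}$, $v^{(t+1)}=v^{(t)}+\alpha_tu^{(t)}$, $r^{(t+1)}=r^{(t)}-\alpha_tHu^{(t)}$, $s^{(t+1)}=P^{-1}r^{(t+1)}$, $\beta_t=\frac{\langle r^{(t+1)},s^{(t+1)}\rangle}{\langle r^{(t)},s^{(t)}\rangle}$, $u^{(t+1)}=s^{(t+1)}+\beta_tu^{(t)}$; until $\|r^{(t+1)}\|_2\le\epsilon_k$. Return $v_k=v^{(t+1)}$ and $\delta_k=\sqrt{v_k^THv^{(t)}+\alpha_tv_k^THu^{(t)}}=\sqrt{v_k^THv_k}$. *)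

theory Defs
  imports "HOL-Analysis.Analysis"
begin

definition gradient :: "(real ^ 'n \<Rightarrow> real) \<Rightarrow> real ^ 'n \<Rightarrow> real ^ 'n" where
  "gradient f w = (THE g. GDERIV f w :> g)"

definition hessian :: "(real ^ 'n \<Rightarrow> real) \<Rightarrow> real ^ 'n \<Rightarrow> real ^ 'n ^ 'n" where
  "hessian f w = jacobian (gradient f) (at w)"

definition third_deriv :: "(real ^ 'n \<Rightarrow> real) \<Rightarrow> real ^ 'n \<Rightarrow> real ^ 'n \<Rightarrow> real ^ 'n ^ 'n" where
  "third_deriv f w u = Lim (at 0) (\<lambda>t::real. (1 / t) *\<^sub>R (hessian f (w + t *\<^sub>R u) - hessian f w))"

definition twice_differentiable :: "(real ^ 'n \<Rightarrow> real) \<Rightarrow> bool" where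
  "twice_differentiable f \<longleftrightarrow>
     (\<forall>w. f differentiable (at w) \<and> gradient f differentiable (at w))"

definition twice_cont_differentiable :: "(real ^ 'n \<Rightarrow> real) \<Rightarrow> bool" where
  "twice_cont_differentiable f \<longleftrightarrow> twice_differentiable f \<and> continuous_on UNIV (hessian f)"

definition thrice_cont_differentiable :: "(real ^ 'n \<Rightarrow> real) \<Rightarrow> bool" where
  "thrice_cont_differentiable f \<longleftrightarrow>
     twice_differentiable f \<and> (\<forall>w. hessian f differentiable (at w)) \<and>
     (\<forall>u. continuous_on UNIV (\<lambda>w. third_deriv f w u))"

definition standard_self_concordant :: "(real ^ 'n \<Rightarrow> real) \<Rightarrow> bool" where
  "standard_self_concordant f \<longleftrightarrow>
     convex_on UNIV f \<and> thrice_cont_differentiable f \<and>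
     (\<forall>w u. \<bar>u \<bullet> (third_deriv f w u *v u)\<bar> \<le> 2 * (u \<bullet> (hessian f w *v u)) powr (3 / 2))"

definition psd :: "real ^ 'n ^ 'n \<Rightarrow> bool" where
  "psd A \<longleftrightarrow> transpose A = A \<and> (\<forall>x. 0 \<le> x \<bullet> (A *v x))"

definition loewner_le :: "real ^ 'n ^ 'n \<Rightarrow> real ^ 'n ^ 'n \<Rightarrow> bool" where
  "loewner_le A B \<longleftrightarrow> psd (B - A)"

text \<open>The norm of the type of matrices is the Frobenius norm, hence the operator norm here.\<close>

definition spectral_norm :: "real ^ 'n ^ 'n \<Rightarrow> real" where
  "spectral_norm A = onorm (\<lambda>x. A *v x)"

definition omega :: "real \<Rightarrow> real" where
  "omega t = t - ln (1 + t)"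

text \<open>The smallest nonnegative integer that is at least \<open>t\<close>; it is 0 for negative \<open>t\<close>.\<close>

definition nceil :: "real \<Rightarrow> nat" where
  "nceil t = nat \<lceil>t\<rceil>"

definition beta :: real where
  "beta = 1 / 20"

text \<open>
  Preconditioned conjugate gradients for \<open>H v = g\<close> with preconditioner \<open>P\<close>: the tuple is
  \<open>(v, r, s, u)\<close> after \<open>t\<close> iterations, started from \<open>v = 0\<close>.  The recursion itself ignores the
  stopping test; the test passes at the end of iteration \<open>t\<close> (counted from 0) if the residual
  with index \<open>t + 1\<close> has norm at most \<open>e\<close>.  The value of \<open>pcg_last\<close> has a meaning only
  if \<open>pcg_halts\<close> holds.  If \<open>g = 0\<close>, the first quotient is 0/0 = 0, and the method
  returns \<open>v = 0\<close> after one iteration.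
\<close>

fun pcg :: "real ^ 'n ^ 'n \<Rightarrow> real ^ 'n ^ 'n \<Rightarrow> real ^ 'n \<Rightarrow> nat
    \<Rightarrow> (real ^ 'n) \<times> (real ^ 'n) \<times> (real ^ 'n) \<times> (real ^ 'n)" where
  "pcg H P g 0 = (0, g, matrix_inv P *v g, matrix_inv P *v g)"
| "pcg H P g (Suc t) =
    (let (v, r, s, u) = pcg H P g t;
         a = (r \<bullet> s) / (u \<bullet> (H *v u));
         v' = v + a *\<^sub>R u;
         r' = r - a *\<^sub>R (H *v u);
         s' = matrix_inv P *v r';
         b = (r' \<bullet> s') / (r \<bullet> s);
         u' = s' + b *\<^sub>R u
     in (v', r', s', u'))"

definition pcg_iterate :: "real ^ 'n ^ 'n \<Rightarrow> real ^ 'n ^ 'n \<Rightarrow> real ^ 'n \<Rightarrow> nat \<Rightarrow> real ^ 'n" where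
  "pcg_iterate H P g t = fst (pcg H P g t)"

definition pcg_residual :: "real ^ 'n ^ 'n \<Rightarrow> real ^ 'n ^ 'n \<Rightarrow> real ^ 'n \<Rightarrow> nat \<Rightarrow> real ^ 'n" where
  "pcg_residual H P g t = fst (snd (pcg H P g t))"

definition pcg_halts :: "real ^ 'n ^ 'n \<Rightarrow> real ^ 'n ^ 'n \<Rightarrow> real ^ 'n \<Rightarrow> real \<Rightarrow> bool" where
  "pcg_halts H P g e \<longleftrightarrow> (\<exists>t. norm (pcg_residual H P g (Suc t)) \<le> e)"

definition pcg_last :: "real ^ 'n ^ 'n \<Rightarrow> real ^ 'n ^ 'n \<Rightarrow> real ^ 'n \<Rightarrow> real \<Rightarrow> nat" where
  "pcg_last H P g e = (LEAST t. norm (pcg_residual H P g (Suc t)) \<le> e)"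

text \<open>
  One outer iteration of DiSCO at the point \<open>w\<close>.  Here \<open>F\<close> is the average of the local
  functions and \<open>f1\<close> is the local function of the master.  The gradient of \<open>F\<close> and its Hessian,
  applied to vectors, are the averages that the machines compute together.
\<close>

definition disco_tol :: "(real ^ 'n \<Rightarrow> real) \<Rightarrow> real \<Rightarrow> real \<Rightarrow> real ^ 'n \<Rightarrow> real" where
  "disco_tol F lam L w = beta * sqrt (lam / L) * norm (gradient F w)"

definition disco_precond :: "(real ^ 'n \<Rightarrow> real) \<Rightarrow> real \<Rightarrow> real ^ 'n \<Rightarrow> real ^ 'n ^ 'n" where
  "disco_precond f1 mu w = hessian f1 w + mat mu"

definition disco_pcg_halts ::
  "(real ^ 'n \<Rightarrow> real) \<Rightarrow> (real ^ 'n \<Rightarrow> real) \<Rightarrow> real \<Rightarrow> real \<Rightarrow> real \<Rightarrow> real ^ 'n \<Rightarrow> bool" where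
  "disco_pcg_halts F f1 mu lam L w =
     pcg_halts (hessian F w) (disco_precond f1 mu w) (gradient F w) (disco_tol F lam L w)"

definition disco_pcg_iterations ::
  "(real ^ 'n \<Rightarrow> real) \<Rightarrow> (real ^ 'n \<Rightarrow> real) \<Rightarrow> real \<Rightarrow> real \<Rightarrow> real \<Rightarrow> real ^ 'n \<Rightarrow> nat" where
  "disco_pcg_iterations F f1 mu lam L w =
     Suc (pcg_last (hessian F w) (disco_precond f1 mu w) (gradient F w) (disco_tol F lam L w))"

definition disco_direction ::
  "(real ^ 'n \<Rightarrow> real) \<Rightarrow> (real ^ 'n \<Rightarrow> real) \<Rightarrow> real \<Rightarrow> real \<Rightarrow> real \<Rightarrow> real ^ 'n \<Rightarrow> real ^ 'n" where
  "disco_direction F f1 mu lam L w =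
     pcg_iterate (hessian F w) (disco_precond f1 mu w) (gradient F w)
       (disco_pcg_iterations F f1 mu lam L w)"

definition disco_decrement ::
  "(real ^ 'n \<Rightarrow> real) \<Rightarrow> (real ^ 'n \<Rightarrow> real) \<Rightarrow> real \<Rightarrow> real \<Rightarrow> real \<Rightarrow> real ^ 'n \<Rightarrow> real" where
  "disco_decrement F f1 mu lam L w =
     (let v = disco_direction F f1 mu lam L w in sqrt (v \<bullet> (hessian F w *v v)))"

definition disco_step ::
  "(real ^ 'n \<Rightarrow> real) \<Rightarrow> (real ^ 'n \<Rightarrow> real) \<Rightarrow> real \<Rightarrow> real \<Rightarrow> real \<Rightarrow> real ^ 'n \<Rightarrow> real ^ 'n" where
  "disco_step F f1 mu lam L w =
     w - (1 / (1 + disco_decrement F f1 mu lam L w)) *\<^sub>R disco_direction F f1 mu lam L w"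

fun disco_iterate :: "(real ^ 'n \<Rightarrow> real) \<Rightarrow> (real ^ 'n \<Rightarrow> real) \<Rightarrow> real \<Rightarrow> real \<Rightarrow> real
    \<Rightarrow> real ^ 'n \<Rightarrow> nat \<Rightarrow> real ^ 'n" where
  "disco_iterate F f1 mu lam L w0 0 = w0"
| "disco_iterate F f1 mu lam L w0 (Suc k) =
     disco_step F f1 mu lam L (disco_iterate F f1 mu lam L w0 k)"

text \<open>
  The outer loop leaves after computing the iterate with index \<open>k + 1\<close>, for the first \<open>k\<close> at
  which the test on the decrement passes.
\<close>

definition disco_last :: "(real ^ 'n \<Rightarrow> real) \<Rightarrow> (real ^ 'n \<Rightarrow> real) \<Rightarrow> real \<Rightarrow> real \<Rightarrow> real
    \<Rightarrow> real \<Rightarrow> real ^ 'n \<Rightarrow> nat \<Rightarrow> bool" where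
  "disco_last F f1 mu lam L eps w0 k \<longleftrightarrow>
     disco_decrement F f1 mu lam L (disco_iterate F f1 mu lam L w0 k) \<le> (1 - beta) * sqrt eps \<and>
     (\<forall>j<k. \<not> disco_decrement F f1 mu lam L (disco_iterate F f1 mu lam L w0 j)
              \<le> (1 - beta) * sqrt eps)"

text \<open>
  Rounds of communication used until the iterate with index \<open>K\<close> is available: one for the
  initialization and, for each outer iteration, one for the gradient and one for each iteration
  of PCG.
\<close>

definition disco_rounds :: "(real ^ 'n \<Rightarrow> real) \<Rightarrow> (real ^ 'n \<Rightarrow> real) \<Rightarrow> real \<Rightarrow> real \<Rightarrow> real
    \<Rightarrow> real ^ 'n \<Rightarrow> nat \<Rightarrow> nat" where
  "disco_rounds F f1 mu lam L w0 K =
     1 + (\<Sum>k<K. 1 + disco_pcg_iterations F f1 mu lam L (disco_iterate F f1 mu lam L w0 k))"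

end

theory Submission
  imports Defs
begin

text \<open>
  Write \<open>n(w)\<close> for the Newton decrement \<open>(f'(w)\<^sup>T f''(w)\<inverse> f'(w))\<^bsup>1/2\<^esup>\<close> and \<open>\<omega>\<^sub>*(t) = -t - log(1 - t)\<close>.
  Self-concordance along lines gives \<open>\<omega>(n(w)) \<le> f(w) - f(w\<^sub>\<star>) \<le> \<omega>\<^sub>*(n(w))\<close>.  A conjugate gradient
  iterate \<open>v\<close> satisfies \<open>f'(w)\<^sup>T v = v\<^sup>T f''(w) v = \<delta>\<^sup>2\<close>, so the damped step decreases \<open>f\<close> by at least
  \<open>\<omega>(\<delta>)\<close>, and by the stopping test \<open>\<delta>\<^sup>2\<close> lies between \<open>(1 - \<beta>\<^sup>2) n(w)\<^sup>2\<close> and \<open>n(w)\<^sup>2\<close>.  Hence \<open>f\<close>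
  drops by \<open>\<omega>(1/6) / 2\<close> as long as \<open>n(w) > 1/6\<close>; afterwards the gap contracts by the factor
  \<open>1 - \<omega>(\<delta>) / \<omega>\<^sub>*(n(w)) \<le> 1/4\<close>, which beats the claimed halving and leaves room for the stopping
  test on \<open>\<delta>\<close>.  This needs only third derivatives of the form \<open>u\<^sup>T (f'''(w)[u]) u\<close>.

  The number of conjugate gradient iterations is bounded by comparison with a Chebyshev
  polynomial.  The identity \<open>T\<^sub>n\<^sup>2 + (1 - X\<^sup>2) U\<^sub>n\<^sub>-\<^sub>1\<^sup>2 = 1\<close> shows that \<open>T\<^sub>n\<close> of a self-adjoint contraction
  is a contraction, without a spectral decomposition.
\<close>

subsection \<open>Conjugate gradients\<close>

text \<open>A positive form has no kernel, which yields a left inverse, and for a square matrix a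
  left inverse is two-sided.\<close>

lemma pos_def_matrix_inv:
  fixes A :: "real ^ 'n ^ 'n"
  assumes "\<And>x. x \<noteq> 0 \<Longrightarrow> 0 < x \<bullet> (A *v x)"
  shows "A *v (matrix_inv A *v x) = x"
proof -
  have "\<exists>B. B ** A = mat 1"
    unfolding matrix_left_invertible_ker using assms by fastforce
  then have "invertible A" by (simp add: invertible_left_inverse)
  then have "\<exists>B. A ** B = mat 1 \<and> B ** A = mat 1" by (simp add: invertible_def)
  then have "A ** matrix_inv A = mat 1 \<and> matrix_inv A ** A = mat 1"
    unfolding matrix_inv_def by (rule someI_ex)
  then show "A *v (matrix_inv A *v x) = x"
    by (simp add: matrix_vector_mul_assoc)
qed

text \<open>Nonnegativity of the form at all combinations of \<open>x\<close> and \<open>y\<close>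
  forces the discriminant bound. The form may degenerate, so \<open>r = 0\<close> is a separate
  case.\<close>

lemma psd_Cauchy_Schwarz:
  fixes A :: "real ^ 'n ^ 'n"
  assumes sym: "\<And>x y. x \<bullet> (A *v y) = (A *v x) \<bullet> y" and psd: "\<And>x. 0 \<le> x \<bullet> (A *v x)"
  shows "(x \<bullet> (A *v y))\<^sup>2 \<le> (x \<bullet> (A *v x)) * (y \<bullet> (A *v y))"
proof -
  define p q r where "p = x \<bullet> (A *v x)" and "q = x \<bullet> (A *v y)" and "r = y \<bullet> (A *v y)"
  have q': "y \<bullet> (A *v x) = q" by (metis q_def sym inner_commute)
  have *: "0 \<le> a\<^sup>2 * p - 2 * a * b * q + b\<^sup>2 * r" for a b
  proof -
    have "0 \<le> (a *\<^sub>R x - b *\<^sub>R y) \<bullet> (A *v (a *\<^sub>R x - b *\<^sub>R y))" by (rule psd)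
    also have "\<dots> = a\<^sup>2 * p - 2 * a * b * q + b\<^sup>2 * r"
      unfolding p_def[symmetric] q_def[symmetric] r_def[symmetric]
      by (simp add: matrix_vector_mult_diff_distrib matrix_vector_mult_scaleR inner_diff_left inner_diff_right
        q' p_def[symmetric] q_def[symmetric] r_def[symmetric] power2_eq_square algebra_simps)
    finally show ?thesis .
  qed
  have "p \<ge> 0" "r \<ge> 0" using psd by (auto simp: p_def r_def)
  show "q\<^sup>2 \<le> p * r"
  proof (cases "r = 0")
    case True
    have "q = 0"
    proof (rule ccontr)
      assume "q \<noteq> 0"
      \<comment> \<open>For \<open>r = 0\<close> the form is affine in \<open>b\<close>; this choice
        of \<open>b\<close> gives it the value -1.\<close>
      have "0 \<le> p - 2 * ((p + 1) / (2 * q)) * q" using *[of 1 "(p + 1) / (2 * q)"] True by simp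
      then show False using \<open>q \<noteq> 0\<close> by simp
    qed
    then show ?thesis using \<open>p \<ge> 0\<close> \<open>r \<ge> 0\<close> by simp
  next
    case False
    have "0 \<le> r * (p * r - q\<^sup>2)" using *[of r q] by (simp add: power2_eq_square algebra_simps)
    then show ?thesis using False \<open>r \<ge> 0\<close> by (simp add: zero_le_mult_iff)
  qed
qed

text \<open>The spectrum of \<open>P\<inverse>H\<close> lies in \<open>[s\<^sup>2, 1]\<close>.\<close>

locale preconditioned =
  fixes H P :: "real ^ 'n ^ 'n" and s :: real and g :: "real ^ 'n"
  assumes H_sym: "\<And>x y. x \<bullet> (H *v y) = (H *v x) \<bullet> y"
    and P_sym: "\<And>x y. x \<bullet> (P *v y) = (P *v x) \<bullet> y"
    and H_pos: "\<And>x. x \<noteq> 0 \<Longrightarrow> 0 < x \<bullet> (H *v x)"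
    and H_le_P: "\<And>x. x \<bullet> (H *v x) \<le> x \<bullet> (P *v x)"
    and P_le_H: "\<And>x. s\<^sup>2 * (x \<bullet> (P *v x)) \<le> x \<bullet> (H *v x)"
    and s_pos: "0 < s" and s_less: "s < 1"
begin

section \<open>The preconditioned operator \<open>M\<close> in the energy inner product
  \<open>ip\<close>\<close>

definition Q :: "real ^ 'n \<Rightarrow> real ^ 'n" where "Q x = matrix_inv P *v x"
definition M :: "real ^ 'n \<Rightarrow> real ^ 'n" where "M x = Q (H *v x)"
definition ip :: "real ^ 'n \<Rightarrow> real ^ 'n \<Rightarrow> real" where "ip x y = x \<bullet> (H *v y)"

lemma ip_add: "ip (x + y) z = ip x z + ip y z" "ip z (x + y) = ip z x + ip z y"
  and ip_diff: "ip (x - y) z = ip x z - ip y z" "ip z (x - y) = ip z x - ip z y"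
  and ip_scaleR: "ip (c *\<^sub>R x) z = c * ip x z" "ip z (c *\<^sub>R x) = c * ip z x"
  by (simp_all add: ip_def inner_add_left inner_add_right matrix_vector_right_distrib
      inner_diff_left inner_diff_right matrix_vector_mult_diff_distrib matrix_vector_mult_scaleR)

lemma ip_commute: "ip x y = ip y x"
  by (metis H_sym inner_commute ip_def)

lemma H_nonneg: "0 \<le> x \<bullet> (H *v x)"
  using H_pos[of x] by (cases "x = 0") auto

lemma ip_nonneg: "0 \<le> ip x x"
  unfolding ip_def by (rule H_nonneg)

lemma P_pos: "x \<noteq> 0 \<Longrightarrow> 0 < x \<bullet> (P *v x)"
  using H_pos[of x] H_le_P[of x] by simp

lemma P_nonneg: "0 \<le> x \<bullet> (P *v x)"
  using P_pos[of x] by (cases "x = 0") auto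

lemma P_Q: "P *v Q x = x"
  unfolding Q_def using pos_def_matrix_inv[of P x] P_pos by simp

lemma Q_linear: "Q (x + y) = Q x + Q y" "Q (x - y) = Q x - Q y" "Q (c *\<^sub>R x) = c *\<^sub>R Q x" "Q 0 = 0"
  by (simp_all add: Q_def matrix_vector_right_distrib matrix_vector_mult_diff_distrib
      matrix_vector_mult_scaleR)

lemma M_linear: "M (x + y) = M x + M y" "M (x - y) = M x - M y" "M (c *\<^sub>R x) = c *\<^sub>R M x" "M 0 = 0"
  by (simp_all add: M_def Q_linear matrix_vector_right_distrib matrix_vector_mult_diff_distrib
      matrix_vector_mult_scaleR)

lemma Q_sym: "x \<bullet> Q y = Q x \<bullet> y"
proof -
  have "x \<bullet> Q y = (P *v Q x) \<bullet> Q y" by (simp add: P_Q)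
  also have "\<dots> = Q x \<bullet> (P *v Q y)" by (simp add: P_sym)
  finally show ?thesis by (simp add: P_Q)
qed

lemma Q_pos: assumes "x \<noteq> 0" shows "0 < x \<bullet> Q x"
proof -
  have "Q x \<noteq> 0" using P_Q[of x] assms by auto
  then have "0 < Q x \<bullet> (P *v Q x)" by (rule P_pos)
  then show ?thesis by (simp add: P_Q inner_commute)
qed

lemma ip_M: "ip x (M y) = ip (M x) y"
  using H_sym Q_sym by (metis M_def ip_def)

lemma P_M: "P *v M x = H *v x"
  by (simp add: M_def P_Q)

text \<open>With \<open>y = M x\<close> one has \<open>P y = H x\<close>, so \<open>ip y x\<close>
  is the \<open>P\<close>-form of \<open>y\<close>. Cauchy-Schwarz for \<open>H\<close> and
  \<open>H_le_P\<close> bound its square by \<open>ip y x * ip x x\<close>; one factor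
  cancels.\<close>

lemma ip_M_le: "ip x (M x) \<le> ip x x"
proof -
  define y where "y = M x"
  have y: "P *v y = H *v x" by (simp add: y_def P_M)
  have "(ip y x)\<^sup>2 \<le> ip y y * ip x x"
    unfolding ip_def by (rule psd_Cauchy_Schwarz) (use H_sym H_nonneg in auto)
  also have "ip y y \<le> ip y x" using H_le_P[of y] by (simp add: ip_def y)
  then have "ip y y * ip x x \<le> ip y x * ip x x" by (rule mult_right_mono) (rule ip_nonneg)
  finally have *: "(ip y x)\<^sup>2 \<le> ip y x * ip x x" by simp
  have "0 \<le> ip y x" using P_nonneg[of y] by (simp add: ip_def y)
  then have "ip y x \<le> ip x x"
  proof (cases "ip y x = 0")
    case False
    with * \<open>0 \<le> ip y x\<close> show ?thesis by (simp add: power2_eq_square)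
  qed (simp add: ip_nonneg)
  then show ?thesis by (simp add: y_def ip_commute)
qed

text \<open>Dual to the upper bound: Cauchy-Schwarz is now applied to \<open>P\<close>, followed by
  \<open>P_le_H\<close>.\<close>

lemma ip_M_ge: "s\<^sup>2 * ip x x \<le> ip x (M x)"
proof -
  define y where "y = M x"
  have y: "P *v y = H *v x" by (simp add: y_def P_M)
  have "s\<^sup>2 * (x \<bullet> (P *v y))\<^sup>2 \<le> s\<^sup>2 * ((x \<bullet> (P *v x)) * (y \<bullet> (P *v y)))"
    by (intro mult_left_mono psd_Cauchy_Schwarz) (use P_sym P_nonneg in auto)
  also have "\<dots> = (s\<^sup>2 * (x \<bullet> (P *v x))) * (y \<bullet> (P *v y))" by simp
  also have "\<dots> \<le> ip x x * (y \<bullet> (P *v y))"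
    by (rule mult_right_mono) (use P_le_H P_nonneg in \<open>auto simp: ip_def\<close>)
  finally have *: "s\<^sup>2 * (ip x x)\<^sup>2 \<le> ip x x * ip y x" by (simp add: y ip_def)
  have "s\<^sup>2 * ip x x \<le> ip y x"
  proof (cases "ip x x = 0")
    case True
    then show ?thesis using P_nonneg[of y] by (simp add: y ip_def)
  next
    case False
    then show ?thesis using * ip_nonneg[of x] by (simp add: power2_eq_square mult.left_commute)
  qed
  then show ?thesis by (simp add: y_def ip_commute)
qed

paragraph \<open>Chebyshev polynomials of \<open>P\<inverse>H\<close>\<close>

definition c :: real where "c = (1 + s\<^sup>2) / (1 - s\<^sup>2)"

text \<open>The affine image of \<open>P\<inverse>H\<close> with spectrum in \<open>[-1, 1]\<close>; its value at the spectral
  point 0 of \<open>P\<inverse>H\<close> is \<open>c\<close>.\<close>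

definition A :: "real ^ 'n \<Rightarrow> real ^ 'n" where
  "A x = c *\<^sub>R x - (2 / (1 - s\<^sup>2)) *\<^sub>R M x"

lemma s2_less: "s\<^sup>2 < 1"
  using s_pos s_less by (simp add: power_less_one_iff)

lemma A_linear: "A (x + y) = A x + A y" "A (x - y) = A x - A y" "A (k *\<^sub>R x) = k *\<^sub>R A x" "A 0 = 0"
  by (simp_all add: A_def M_linear algebra_simps)

lemma ip_A: "ip x (A y) = ip (A x) y"
  by (simp add: A_def ip_diff ip_scaleR ip_M)

text \<open>Up to a positive factor \<open>1 - A^2\<close> is \<open>(1 - M) (M - s^2)\<close>. To
  see that this product is nonnegative, the two form bounds are applied to \<open>(1 - M) x\<close>
  and \<open>(M - s^2) x\<close>; their sum is \<open>1 - s^2\<close> times the form of the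
  product.\<close>

lemma ip_A_norm_le: "ip (A x) (A x) \<le> ip x x"
proof -
  define d where "d = 1 - s\<^sup>2"
  have d: "d > 0" using s2_less by (simp add: d_def)
  define p q where "p = x - M x" and "q = M x - s\<^sup>2 *\<^sub>R x"
  have a1: "0 \<le> ip p (M p) - s\<^sup>2 * ip p p" using ip_M_ge[of p] by simp
  have a2: "0 \<le> ip q q - ip q (M q)" using ip_M_le[of q] by simp
  have [simp]: "ip (M x) x = ip x (M x)" by (simp add: ip_M)
  have [simp]: "ip x (M (M x)) = ip (M x) (M x)" by (simp add: ip_M)
  have [simp]: "ip (M (M x)) x = ip (M x) (M x)" by (simp add: ip_M)
  have "(ip p (M p) - s\<^sup>2 * ip p p) + (ip q q - ip q (M q))
      = d * ((1 + s\<^sup>2) * ip x (M x) - s\<^sup>2 * ip x x - ip (M x) (M x))"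
    unfolding p_def q_def d_def
    by (simp add: ip_diff ip_scaleR M_linear algebra_simps power2_eq_square)
  with a1 a2 d have pos: "0 \<le> (1 + s\<^sup>2) * ip x (M x) - s\<^sup>2 * ip x x - ip (M x) (M x)"
    by (metis add_nonneg_nonneg zero_le_mult_iff not_less)
  have dA: "d *\<^sub>R A x = (1 + s\<^sup>2) *\<^sub>R x - 2 *\<^sub>R M x"
    using d unfolding A_def c_def d_def[symmetric] by (simp add: scaleR_diff_right)
  have "d\<^sup>2 * (ip x x - ip (A x) (A x)) = d\<^sup>2 * ip x x - ip (d *\<^sub>R A x) (d *\<^sub>R A x)"
    by (simp add: ip_scaleR power2_eq_square algebra_simps)
  also have "\<dots> = 4 * ((1 + s\<^sup>2) * ip x (M x) - s\<^sup>2 * ip x x - ip (M x) (M x))"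
    unfolding dA by (simp add: ip_diff ip_add ip_scaleR d_def algebra_simps power2_eq_square)
  finally have "0 \<le> d\<^sup>2 * (ip x x - ip (A x) (A x))" using pos by simp
  then show ?thesis using d by (simp add: zero_le_mult_iff)
qed

text \<open>\<open>(T\<^sub>n(A) e, U\<^sub>n\<^sub>-\<^sub>1(A) e)\<close> for the Chebyshev polynomials of the first and second kind.\<close>

fun cheb :: "real ^ 'n \<Rightarrow> nat \<Rightarrow> (real ^ 'n) \<times> (real ^ 'n)" where
  "cheb e 0 = (e, 0)"
| "cheb e (Suc n) = (let (x, y) = cheb e n; y' = A y + x in (A y' - y, y'))"

text \<open>The same recursion at the scalar \<open>c\<close>, giving \<open>T_n(c)\<close> and
  \<open>U_{n-1}(c)\<close>; the first normalizes the comparison polynomial.\<close>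

fun chebc :: "nat \<Rightarrow> real \<times> real" where
  "chebc 0 = (1, 0)"
| "chebc (Suc n) = (let (x, y) = chebc n; y' = c * y + x in (c * y' - y, y'))"

text \<open>The operator form of \<open>T\<^sub>n\<^sup>2 + (1 - X\<^sup>2) U\<^sub>n\<^sub>-\<^sub>1\<^sup>2 = 1\<close>.\<close>

lemma cheb_Pell:
  "ip (fst (cheb e n)) (fst (cheb e n))
     + ip (snd (cheb e n)) (snd (cheb e n)) - ip (A (snd (cheb e n))) (A (snd (cheb e n))) = ip e e"
proof (induction n)
  case 0
  then show ?case by (simp add: A_linear ip_def)
next
  case (Suc n)
  obtain x y where xy: "cheb e n = (x, y)" by fastforce
  define z where "z = A y + x"
  have "ip (A z) y = ip z (A y)" by (rule ip_A[symmetric])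
  moreover have "ip y (A z) = ip (A z) y" "ip (A y) z = ip z (A y)" by (rule ip_commute)+
  ultimately have "ip (A z - y) (A z - y) + ip z z - ip (A z) (A z) = ip (z - A y) (z - A y) + ip y y - ip (A y) (A y)"
    unfolding ip_diff by linarith
  then show ?case using Suc.IH by (simp add: xy Let_def z_def)
qed

lemma cheb_bound: "ip (fst (cheb e n)) (fst (cheb e n)) \<le> ip e e"
  using cheb_Pell[of e n] ip_A_norm_le[of "snd (cheb e n)"] by linarith

text \<open>\<open>T_n(c)\<close> is the mean of \<open>(c + h)^n\<close> and
  \<open>(c - h)^n\<close> for \<open>h^2 = c^2 - 1\<close>. Here \<open>c + h\<close> is
  \<open>(1 + s) / (1 - s)\<close>, and the second power is dropped.\<close>

lemma chebc_lower: "((1 + s) / (1 - s)) ^ n / 2 \<le> fst (chebc n)"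
proof -
  define h where "h = 2 * s / (1 - s\<^sup>2)"
  have d: "1 - s\<^sup>2 = (1 - s) * (1 + s)" by (simp add: power2_eq_square algebra_simps)
  have nz: "1 - s > 0" "1 + s > 0" using s_pos s_less by auto
  have c1: "c + h = (1 + s) / (1 - s)"
  proof -
    have "c + h = (1 + s)\<^sup>2 / ((1 - s) * (1 + s))"
      unfolding c_def h_def d by (simp add: add_divide_distrib[symmetric] power2_eq_square algebra_simps)
    then show ?thesis using nz by (simp add: power2_eq_square)
  qed
  have c2: "c - h = (1 - s) / (1 + s)"
  proof -
    have "c - h = (1 - s)\<^sup>2 / ((1 - s) * (1 + s))"
      unfolding c_def h_def d by (simp add: diff_divide_distrib[symmetric] power2_eq_square algebra_simps)
    then show ?thesis using nz by (simp add: power2_eq_square)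
  qed
  have "(c + h) * (c - h) = 1" unfolding c1 c2 using nz by simp
  then have hh: "h * h = c * c - 1" by (simp add: algebra_simps)
  have "fst (chebc n) + h * snd (chebc n) = (c + h) ^ n \<and> fst (chebc n) - h * snd (chebc n) = (c - h) ^ n"
  proof (induction n)
    case (Suc n)
    obtain x y where xy: "chebc n = (x, y)" by fastforce
    have "(c + h) * (x + h * y) = c * (c * y + x) - y + h * (c * y + x)"
      using arg_cong[OF hh, of "\<lambda>w. w * y"] by (simp add: algebra_simps)
    moreover have "(c - h) * (x - h * y) = c * (c * y + x) - y - h * (c * y + x)"
      using arg_cong[OF hh, of "\<lambda>w. w * y"] by (simp add: algebra_simps)
    ultimately show ?case using Suc.IH by (simp add: xy Let_def)
  qed simp
  then have "2 * fst (chebc n) = (c + h) ^ n + (c - h) ^ n" by linarith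
  moreover have "(c - h) ^ n \<ge> 0" unfolding c2 using nz by simp
  ultimately show ?thesis unfolding c1 by simp
qed

paragraph \<open>Optimality on the Krylov spaces\<close>

definition res :: "nat \<Rightarrow> real ^ 'n" where "res t = pcg_residual H P g t"
definition sol :: "nat \<Rightarrow> real ^ 'n" where "sol t = pcg_iterate H P g t"
definition dir :: "nat \<Rightarrow> real ^ 'n" where "dir t = snd (snd (snd (pcg H P g t)))"
definition alpha :: "nat \<Rightarrow> real" where "alpha t = (res t \<bullet> Q (res t)) / ip (dir t) (dir t)"
text \<open>The coefficient beta_t of the algorithm; the name \<open>beta\<close> denotes the
  constant of the stopping test.\<close>

definition gam :: "nat \<Rightarrow> real" where
  "gam t = (res (Suc t) \<bullet> Q (res (Suc t))) / (res t \<bullet> Q (res t))"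
text \<open>Spanned by the search directions, so that orthogonality to the space can be checked on
  generators; invariance under \<open>M\<close>, up to one dimension, is then a result
  (\<open>M_Krylov\<close>).\<close>

definition Krylov :: "nat \<Rightarrow> (real ^ 'n) set" where "Krylov t = span (dir ` {..<t})"

lemma pcg_eq: "pcg H P g t = (sol t, res t, Q (res t), dir t)"
  by (induction t) (auto simp: sol_def res_def dir_def pcg_iterate_def pcg_residual_def Q_def Let_def
      split: prod.splits)

lemma pcg_0: "sol 0 = 0" "res 0 = g" "dir 0 = Q g"
  by (simp_all add: sol_def res_def dir_def pcg_iterate_def pcg_residual_def Q_def)

lemma
  shows sol_Suc: "sol (Suc t) = sol t + alpha t *\<^sub>R dir t"
    and res_Suc: "res (Suc t) = res t - alpha t *\<^sub>R (H *v dir t)"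
    and dir_Suc: "dir (Suc t) = Q (res (Suc t)) + gam t *\<^sub>R dir t"
  using pcg_eq[of "Suc t"] pcg_eq[of t]
  by (auto simp: Let_def alpha_def gam_def ip_def Q_def)

lemma dir_in_Krylov: "i < t \<Longrightarrow> dir i \<in> Krylov t"
  unfolding Krylov_def by (rule span_base) auto

lemma Krylov_mono: "i \<le> t \<Longrightarrow> x \<in> Krylov i \<Longrightarrow> x \<in> Krylov t"
  unfolding Krylov_def using span_mono[of "dir ` {..<i}" "dir ` {..<t}"] by (auto simp: image_mono)

lemma Krylov_subspace: "subspace (Krylov t)"
  by (simp add: Krylov_def)

lemmas Krylov_closed = Krylov_subspace[THEN subspace_add] Krylov_subspace[THEN subspace_diff]
  Krylov_subspace[THEN subspace_scale] Krylov_subspace[THEN subspace_0]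

lemma Q_res_in_Krylov: "Q (res t) \<in> Krylov (Suc t)"
proof (cases t)
  case 0
  then show ?thesis using dir_in_Krylov[of 0 1] by (simp add: pcg_0)
next
  case (Suc t')
  have "Q (res (Suc t')) = dir (Suc t') - gam t' *\<^sub>R dir t'" by (simp add: dir_Suc)
  moreover have "\<dots> \<in> Krylov (Suc (Suc t'))" by (intro Krylov_closed dir_in_Krylov) auto
  ultimately show ?thesis using Suc by simp
qed

lemma Krylov_orth:
  assumes "\<And>i. i < t \<Longrightarrow> x \<bullet> dir i = 0" and "y \<in> Krylov t"
  shows "x \<bullet> y = 0"
  using assms(2) unfolding Krylov_def
proof (induction rule: span_induct)
  case base
  show ?case by (auto simp: subspace_def inner_add_right)
qed (use assms(1) in auto)

lemma res_inner_dir: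
  assumes "\<And>i. i < t \<Longrightarrow> res t \<bullet> dir i = 0"
  shows "res t \<bullet> dir t = res t \<bullet> Q (res t)"
proof (cases t)
  case (Suc t')
  then show ?thesis using assms[of t'] by (simp add: dir_Suc[of t'] inner_add_right)
qed (simp add: pcg_0)

lemma Q_zero_iff: "x \<bullet> Q x = 0 \<longleftrightarrow> x = 0"
  using Q_pos[of x] by (cases "x = 0") auto

lemma ip_zero_iff: "ip x x = 0 \<longleftrightarrow> x = 0"
  unfolding ip_def using H_pos[of x] by (cases "x = 0") auto

text \<open>Also true when the quotient is 0/0: a vanishing direction makes the numerator vanish by
  \<open>res_inner_dir\<close>.\<close>

lemma alpha_mult:
  assumes "\<And>i. i < t \<Longrightarrow> res t \<bullet> dir i = 0"
  shows "alpha t * ip (dir t) (dir t) = res t \<bullet> Q (res t)"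
proof (cases "dir t = 0")
  case True
  then show ?thesis using res_inner_dir[OF assms] by (simp add: ip_def)
next
  case False
  then show ?thesis by (simp add: alpha_def ip_zero_iff)
qed

text \<open>Covers the recursion past an exact solution: a zero residual makes the numerator of
  \<open>gam\<close> zero, so the old direction is discarded too.\<close>

lemma res_zero_imp_dir_zero: "res t = 0 \<Longrightarrow> dir t = 0"
  proof (cases t)
  case 0
  have "dir 0 = Q (res 0)" by (simp add: pcg_0)
  then show "res t = 0 \<Longrightarrow> dir t = 0" using 0 by (simp add: Q_linear)
qed (simp add: dir_Suc gam_def Q_linear)

text \<open>The residual update, multiplied by the inverse of \<open>P\<close>, expresses
  \<open>M (dir t)\<close> through two consecutive preconditioned residuals, divided by
  \<open>alpha t\<close>; for \<open>alpha t = 0\<close> the direction itself is zero.\<close>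

lemma M_dir_in_Krylov:
  assumes "\<And>i. i < t \<Longrightarrow> res t \<bullet> dir i = 0"
  shows "M (dir t) \<in> Krylov (Suc (Suc t))"
proof (cases "alpha t = 0")
  case True
  then have "res t \<bullet> Q (res t) = 0" using alpha_mult[OF assms] by simp
  then have "dir t = 0" by (simp add: Q_zero_iff res_zero_imp_dir_zero)
  then show ?thesis by (simp add: M_linear Krylov_closed)
next
  case False
  have "alpha t *\<^sub>R M (dir t) = Q (res t) - Q (res (Suc t))"
    by (simp add: res_Suc Q_linear M_def)
  then have "M (dir t) = (1 / alpha t) *\<^sub>R (Q (res t) - Q (res (Suc t)))"
    using False by (metis divide_inverse_commute mult.right_neutral scaleR_scaleR left_inverse scaleR_one)
  moreover have "Q (res t) \<in> Krylov (Suc (Suc t))"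
    using Q_res_in_Krylov[of t] Krylov_mono by (meson le_SucI order_refl)
  ultimately show ?thesis using Q_res_in_Krylov[of "Suc t"] by (simp add: Krylov_closed)
qed

text \<open>Both orthogonalities go through one strong induction. Conjugacy to older directions
  holds because \<open>M\<close> moves them into \<open>Krylov t\<close>, which is orthogonal to the
  new residual; conjugacy to the last one is what the value of \<open>gam\<close> achieves.\<close>

lemma cg_orthogonality:
  "i < t \<Longrightarrow> res t \<bullet> dir i = 0 \<and> ip (dir t) (dir i) = 0"
proof (induction t arbitrary: i rule: less_induct)
  case (less t)
  then obtain t' where t: "t = Suc t'" by (cases t) auto
  have IH: "res j \<bullet> dir i = 0" "ip (dir j) (dir i) = 0" if "j \<le> t'" "i < j" for i j
    using less.IH[of j i] that by (auto simp: t)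
  have orth: "res t \<bullet> dir i = 0" if "i < t" for i
  proof (cases "i = t'")
    case True
    have "res t \<bullet> dir t' = res t' \<bullet> dir t' - alpha t' * ip (dir t') (dir t')"
      by (simp add: t res_Suc inner_diff_left ip_def H_sym)
    then show ?thesis using True alpha_mult[of t'] res_inner_dir[of t'] IH(1) by simp
  next
    case False
    then have "i < t'" using that by (simp add: t)
    moreover have "res t \<bullet> dir i = res t' \<bullet> dir i - alpha t' * ip (dir t') (dir i)"
      by (simp add: t res_Suc inner_diff_left ip_def H_sym)
    ultimately show ?thesis using IH by simp
  qed
  have conj: "ip (dir t) (dir i) = 0" if "i < t" for i
  proof -
    have QM: "ip (Q (res t)) (dir i) = res t \<bullet> M (dir i)"
      by (simp add: ip_def M_def Q_sym)
    have split: "ip (dir t) (dir i) = res t \<bullet> M (dir i) + gam t' * ip (dir t') (dir i)"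
      by (simp add: t dir_Suc ip_add ip_scaleR QM[unfolded t])
    show ?thesis
    proof (cases "i = t'")
      case False
      then have "i < t'" using that by (simp add: t)
      then have "M (dir i) \<in> Krylov t"
        by (intro Krylov_mono[OF _ M_dir_in_Krylov]) (auto simp: t intro: IH)
      then have "res t \<bullet> M (dir i) = 0" by (rule Krylov_orth[rotated]) (rule orth)
      then show ?thesis using split IH(2)[of t' i] \<open>i < t'\<close> by simp
    next
      case True
      show ?thesis
      proof (cases "alpha t' = 0")
        case a0: True
        then have "res t' \<bullet> Q (res t') = 0" using alpha_mult[of t'] IH(1) by simp
        then have "res t' = 0" by (simp add: Q_zero_iff)
        then have "res t = 0" using a0 by (simp add: t res_Suc)
        then have "dir t = 0" by (rule res_zero_imp_dir_zero)
        then show ?thesis by (simp add: ip_def)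
      next
        case a0: False
        have "Q (res t') \<in> Krylov t" using Q_res_in_Krylov by (simp add: t)
        then have q: "res t \<bullet> Q (res t') = 0" by (rule Krylov_orth[rotated]) (rule orth)
        have "alpha t' *\<^sub>R M (dir t') = Q (res t') - Q (res t)"
          by (simp add: t res_Suc Q_linear M_def)
        then have "alpha t' * (res t \<bullet> M (dir t')) = res t \<bullet> (Q (res t') - Q (res t))"
          by (metis inner_scaleR_right)
        also have "\<dots> = - (res t \<bullet> Q (res t))"
          using q by (simp add: inner_diff_right)
        finally have 1: "alpha t' * (res t \<bullet> M (dir t')) = - (res t \<bullet> Q (res t))" .
        have nz: "res t' \<noteq> 0" using a0 by (auto simp: alpha_def)
        have "alpha t' * (gam t' * ip (dir t') (dir t')) = gam t' * (res t' \<bullet> Q (res t'))"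
          using alpha_mult[of t'] IH(1) by (simp add: mult.left_commute)
        also have "\<dots> = res t \<bullet> Q (res t)" using nz by (simp add: gam_def t Q_zero_iff)
        finally have "alpha t' * ip (dir t) (dir t') = 0"
          using 1 split True by (simp add: distrib_left)
        then show ?thesis using a0 True by simp
      qed
    qed
  qed
  show ?case using orth conj less.prems by simp
qed

lemma M_Krylov: assumes "x \<in> Krylov t" shows "M x \<in> Krylov (Suc t)"
  using assms unfolding Krylov_def[of t]
proof (induction rule: span_induct)
  case base
  show ?case by (auto simp: subspace_def M_linear Krylov_closed)
next
  case (step x)
  then obtain i where "x = dir i" "i < t" by auto
  then show ?case
    using M_dir_in_Krylov[of i] cg_orthogonality Krylov_mono[of "Suc (Suc i)" "Suc t"] by auto
qed

lemma sol_in_Krylov: "sol t \<in> Krylov t"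
proof (induction t)
  case (Suc t)
  then show ?case unfolding sol_Suc
    by (intro Krylov_closed dir_in_Krylov) (use Krylov_mono[of t "Suc t"] in auto)
qed (simp add: pcg_0 Krylov_closed)

lemma res_eq: "res t = g - H *v sol t"
  by (induction t) (simp_all add: pcg_0 sol_Suc res_Suc matrix_vector_right_distrib matrix_vector_mult_scaleR)

lemma res_orth: "y \<in> Krylov t \<Longrightarrow> res t \<bullet> y = 0"
  using Krylov_orth cg_orthogonality by blast

text \<open>The iterate lies in the space to which its own residual is orthogonal. This supplies the
  inner product with the gradient that the damped step requires.\<close>

lemma energy_sol: "sol t \<bullet> (H *v sol t) = g \<bullet> sol t"
  using res_orth[OF sol_in_Krylov, of t] by (simp add: res_eq inner_diff_left H_sym)

text \<open>Pythagoras: the error is orthogonal to the Krylov space in the energy inner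
  product.\<close>

lemma cg_optimal:
  assumes e: "H *v e = g" and z: "z \<in> Krylov t"
  shows "ip (e - sol t) (e - sol t) \<le> ip (e - z) (e - z)"
proof -
  have "sol t - z \<in> Krylov t" using z sol_in_Krylov by (simp add: Krylov_closed)
  then have "res t \<bullet> (sol t - z) = 0" by (rule res_orth)
  then have 0: "ip (e - sol t) (sol t - z) = 0"
    by (simp add: ip_def res_eq H_sym matrix_vector_mult_diff_distrib[of H e] e)
  have "ip (e - z) (e - z) = ip ((e - sol t) + (sol t - z)) ((e - sol t) + (sol t - z))" by simp
  also have "\<dots> = ip (e - sol t) (e - sol t) + ip (sol t - z) (sol t - z)"
    using 0 by (simp only: ip_add ip_commute[of "sol t - z" "e - sol t"])
  finally show ?thesis using ip_nonneg[of "sol t - z"] by simp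
qed

text \<open>A polynomial in \<open>M\<close> minus its value at 0 has a factor \<open>M\<close>, and
  \<open>M e\<close> is the first direction. The third conjunct records that \<open>U_n\<close> has
  degree only \<open>n\<close>; without it each inductive step would lose a dimension.\<close>

lemma cheb_Krylov:
  assumes e: "H *v e = g"
  shows "fst (cheb e n) - fst (chebc n) *\<^sub>R e \<in> Krylov n
    \<and> snd (cheb e n) - snd (chebc n) *\<^sub>R e \<in> Krylov n
    \<and> snd (cheb e (Suc n)) - snd (chebc (Suc n)) *\<^sub>R e \<in> Krylov n"
proof -
  have step: "A x - (c * k) *\<^sub>R e \<in> Krylov (Suc n)" if "x - k *\<^sub>R e \<in> Krylov n" for x k n
  proof -
    have "M e = dir 0" by (simp add: M_def e pcg_0)
    then have "M e \<in> Krylov (Suc n)" by (simp add: dir_in_Krylov)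
    moreover have "M (x - k *\<^sub>R e) \<in> Krylov (Suc n)" using that by (rule M_Krylov)
    moreover have "x - k *\<^sub>R e \<in> Krylov (Suc n)" using that Krylov_mono by (meson le_SucI order_refl)
    ultimately have "c *\<^sub>R (x - k *\<^sub>R e) - (2 / (1 - s\<^sup>2)) *\<^sub>R (M (x - k *\<^sub>R e) + k *\<^sub>R M e) \<in> Krylov (Suc n)"
      by (simp add: Krylov_closed)
    then show ?thesis by (simp add: A_def M_linear algebra_simps)
  qed
  show ?thesis
  proof (induction n)
    case 0
    then show ?case by (simp add: A_linear Krylov_closed)
  next
    case (Suc n)
    obtain x y where xy: "cheb e n = (x, y)" by fastforce
    obtain p q where pq: "chebc n = (p, q)" by fastforce
    define y' where "y' = A y + x"
    define q' where "q' = c * q + p"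
    have IH: "x - p *\<^sub>R e \<in> Krylov n" "y - q *\<^sub>R e \<in> Krylov n" "y' - q' *\<^sub>R e \<in> Krylov n"
      using Suc.IH by (simp_all add: xy pq Let_def y'_def q'_def)
    have m: "z \<in> Krylov (Suc n)" if "z \<in> Krylov n" for z
      using that Krylov_mono by (meson le_SucI order_refl)
    have 1: "(A y' - y) - (c * q' - q) *\<^sub>R e \<in> Krylov (Suc n)"
      using Krylov_closed(2)[OF step[OF IH(3)] m[OF IH(2)]] by (simp add: algebra_simps)
    have 2: "(A y' + (A y' - y)) - (c * q' + (c * q' - q)) *\<^sub>R e \<in> Krylov (Suc n)"
      using Krylov_closed(1)[OF step[OF IH(3)] 1]
      by (simp only: add_diff_add[symmetric] scaleR_left.add[symmetric])
    show ?case using 1 2 m[OF IH(3)]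
      by (simp add: xy pq Let_def y'_def[symmetric] q'_def[symmetric])
  qed
qed

text \<open>This is \<open>s \<le> artanh s\<close>, obtained by comparing derivatives; it turns the
  geometric rate into an exponential one.\<close>

lemma exp_le_ratio: "exp (2 * s) \<le> (1 + s) / (1 - s)"
proof -
  let ?h = "\<lambda>x::real. ln (1 + x) - ln (1 - x) - 2 * x"
  have "?h 0 \<le> ?h s"
  proof (rule DERIV_nonneg_imp_nondecreasing[of 0 s ?h])
    show "0 \<le> s" using s_pos by simp
  next
    fix x assume x: "0 \<le> x" "x \<le> s"
    then have x1: "x < 1" using s_less by simp
    have "(?h has_real_derivative (1 / (1 + x) + 1 / (1 - x) - 2)) (at x)"
      using x x1 by (auto intro!: derivative_eq_intros)
    moreover have "1 / (1 + x) + 1 / (1 - x) - 2 = 2 * x\<^sup>2 / ((1 + x) * (1 - x))"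
      using x x1 by (simp add: divide_simps) (simp add: power2_eq_square algebra_simps)
    then have "0 \<le> 1 / (1 + x) + 1 / (1 - x) - 2" using x x1 by simp
    ultimately show "\<exists>y. (?h has_real_derivative y) (at x) \<and> 0 \<le> y" by blast
  qed
  then have "2 * s \<le> ln ((1 + s) / (1 - s))" using s_pos s_less by (simp add: ln_div)
  moreover have "0 < (1 + s) / (1 - s)" using s_pos s_less by simp
  ultimately show ?thesis by (simp add: ln_ge_iff)
qed

lemma pcg_energy_bound:
  assumes e: "H *v e = g"
  shows "ip (e - sol t) (e - sol t) \<le> (2 * exp (- (2 * s * real t)))\<^sup>2 * ip e e"
proof -
  define p where "p = fst (chebc t)"
  have "exp (2 * s * real t) = exp (2 * s) ^ t" by (simp add: exp_of_nat_mult mult.commute)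
  also have "\<dots> \<le> ((1 + s) / (1 - s)) ^ t" by (rule power_mono[OF exp_le_ratio]) simp
  also have "\<dots> \<le> 2 * p" using chebc_lower[of t] by (simp add: p_def)
  finally have p: "exp (2 * s * real t) \<le> 2 * p" .
  then have "p > 0" using exp_gt_zero[of "2 * s * real t"] by linarith
  have "1 / p \<le> 2 / exp (2 * s * real t)" using p \<open>p > 0\<close> by (simp add: field_simps)
  then have ip: "1 / p \<le> 2 * exp (- (2 * s * real t))" by (simp add: exp_minus field_simps)
  \<comment> \<open>The error of \<open>z\<close> is \<open>T_t(A) e / T_t(c)\<close>, a polynomial
    in \<open>M\<close> with value 1 at 0 applied to \<open>e\<close>, which puts \<open>z\<close>
    into the Krylov space.\<close>
  define z where "z = e - (1 / p) *\<^sub>R fst (cheb e t)"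
  have "(- (1 / p)) *\<^sub>R (fst (cheb e t) - p *\<^sub>R e) \<in> Krylov t"
    using cheb_Krylov[OF e, of t] unfolding p_def by (blast intro: Krylov_closed(3))
  then have "z \<in> Krylov t" using \<open>p > 0\<close> by (simp add: z_def algebra_simps)
  then have "ip (e - sol t) (e - sol t) \<le> ip (e - z) (e - z)" by (rule cg_optimal[OF e])
  also have "\<dots> = (1 / p)\<^sup>2 * ip (fst (cheb e t)) (fst (cheb e t))"
    by (simp add: z_def ip_scaleR power2_eq_square)
  also have "\<dots> \<le> (1 / p)\<^sup>2 * ip e e" by (intro mult_left_mono cheb_bound) simp
  also have "\<dots> \<le> (2 * exp (- (2 * s * real t)))\<^sup>2 * ip e e"
    by (rule mult_right_mono[OF power_mono[OF ip] ip_nonneg]) (use \<open>p > 0\<close> in simp)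
  finally show ?thesis .
qed

end

subsection \<open>Gradients and Hessians\<close>

lemma gradient_works:
  assumes "f differentiable (at w)"
  shows "(f has_derivative (\<lambda>h. h \<bullet> gradient f w)) (at w)"
proof -
  obtain f' where f': "(f has_derivative f') (at w)"
    using assms by (auto simp: differentiable_def)
  have "linear f'" using f' by (rule has_derivative_linear)
  then have "f' = (\<lambda>h. h \<bullet> adjoint f' 1)" by (simp add: adjoint_works)
  then have g: "GDERIV f w :> adjoint f' 1" using f' by (simp add: gderiv_def)
  have "GDERIV f w :> gradient f w"
    unfolding gradient_def
  proof (rule theI[of _ "adjoint f' 1"])
    fix d assume "GDERIV f w :> d"
    then have "(\<lambda>h. h \<bullet> d) = (\<lambda>h. h \<bullet> adjoint f' 1)"
      using g unfolding gderiv_def by (rule has_derivative_unique)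
    then show "d = adjoint f' 1" by (metis vector_eq_ldot)
  qed (fact g)
  then show ?thesis by (simp add: gderiv_def)
qed

lemma hessian_works:
  assumes "gradient f differentiable (at w)"
  shows "(gradient f has_derivative (\<lambda>h. hessian f w *v h)) (at w)"
  using assms unfolding hessian_def by (simp add: jacobian_works)

text \<open>\<open>Lim\<close> is informative only if the limit exists. Differentiability of the
  Hessian provides it and makes the result linear in the direction.\<close>

lemma third_deriv_works:
  assumes "hessian f differentiable (at w)"
  shows "(hessian f has_derivative third_deriv f w) (at w)"
proof -
  obtain D where D: "(hessian f has_derivative D) (at w)"
    using assms by (auto simp: differentiable_def)
  have "third_deriv f w u = D u" for u
  proof -
    have "((\<lambda>t::real. w + t *\<^sub>R u) has_derivative (\<lambda>t. t *\<^sub>R u)) (at 0)"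
      by (auto intro!: derivative_eq_intros)
    then have "((\<lambda>t::real. hessian f (w + t *\<^sub>R u)) has_derivative (\<lambda>t. D (t *\<^sub>R u))) (at 0)"
      by (rule has_derivative_compose) (simp add: D)
    then have "((\<lambda>t::real. hessian f (w + t *\<^sub>R u)) has_derivative (\<lambda>t. t *\<^sub>R D u)) (at 0)"
      using linear_scale[OF has_derivative_linear[OF D]] by simp
    then have lim: "((\<lambda>t. norm (hessian f (w + t *\<^sub>R u) - hessian f w - t *\<^sub>R D u) / norm t) \<longlongrightarrow> 0) (at 0)"
      by (simp add: has_derivative_at)
    let ?q = "\<lambda>t::real. (1 / t) *\<^sub>R (hessian f (w + t *\<^sub>R u) - hessian f w) - D u"
    have "norm (hessian f (w + t *\<^sub>R u) - hessian f w - t *\<^sub>R D u) / norm t = norm (?q t)"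
      if "t \<noteq> 0" for t
    proof -
      have "hessian f (w + t *\<^sub>R u) - hessian f w - t *\<^sub>R D u = t *\<^sub>R ?q t"
        using that by (simp add: scaleR_diff_right)
      then show ?thesis using that by simp
    qed
    then have "\<forall>\<^sub>F t in at 0. norm (hessian f (w + t *\<^sub>R u) - hessian f w - t *\<^sub>R D u) / norm t = norm (?q t)"
      by (simp add: eventually_at_filter)
    from Lim_transform_eventually[OF lim this] have "(?q \<longlongrightarrow> 0) (at 0)"
      by (rule tendsto_norm_zero_cancel)
    then have "((\<lambda>t::real. (1 / t) *\<^sub>R (hessian f (w + t *\<^sub>R u) - hessian f w)) \<longlongrightarrow> D u) (at 0)"
      by (rule LIM_zero_cancel)
    then show ?thesis unfolding third_deriv_def by (intro tendsto_Lim) auto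
  qed
  then have "third_deriv f w = D" by (rule ext)
  then show ?thesis using D by simp
qed

lemma deriv_along_line:
  assumes "(f has_derivative f') (at (w + t *\<^sub>R h))"
  shows "((\<lambda>t. f (w + t *\<^sub>R h)) has_vector_derivative f' h) (at t)"
proof -
  have "((\<lambda>t::real. w + t *\<^sub>R h) has_derivative (\<lambda>t. t *\<^sub>R h)) (at t)"
    by (auto intro!: derivative_eq_intros)
  then have "((\<lambda>t::real. f (w + t *\<^sub>R h)) has_derivative (\<lambda>t. f' (t *\<^sub>R h))) (at t)"
    by (rule has_derivative_compose) (simp add: assms)
  then show ?thesis unfolding has_vector_derivative_def
    using linear_scale[OF has_derivative_linear[OF assms]] by simp
qed

text \<open>The mean value theorem in direction \<open>u\<close> reduces the second difference to a
  difference of gradients, which is then expanded to first order at \<open>w\<close>. This handles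
  functions such as \<open>f 1\<close> that are assumed merely twice differentiable.\<close>

lemma second_difference_tendsto:
  fixes f :: "real ^ 'n \<Rightarrow> real"
  assumes f: "\<And>w. f differentiable (at w)" and g: "gradient f differentiable (at w)"
  shows "((\<lambda>t. (f (w + t *\<^sub>R u + t *\<^sub>R v) - f (w + t *\<^sub>R u) - f (w + t *\<^sub>R v) + f w) / t\<^sup>2)
    \<longlongrightarrow> u \<bullet> (hessian f w *v v)) (at_right 0)"
    (is "((\<lambda>t. ?S t / t\<^sup>2) \<longlongrightarrow> ?l) _")
proof (rule tendstoI)
  fix e :: real assume "e > 0"
  define N where "N = norm u + norm v + 1"
  \<comment> \<open>Two remainders of size at most \<open>e' * (t * N)\<close>, paired with
    \<open>u\<close>, then add up to at most \<open>t * (e / 2)\<close>.\<close>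
  define e' where "e' = e / (4 * N * N)"
  have "N > 0" by (simp add: N_def add_nonneg_pos)
  then have "e' > 0" using \<open>e > 0\<close> by (simp add: e'_def)
  obtain d where d: "d > 0" "\<And>y. norm (y - w) < d \<Longrightarrow>
      norm (gradient f y - gradient f w - hessian f w *v (y - w)) \<le> e' * norm (y - w)"
    using hessian_works[OF g] \<open>e' > 0\<close> unfolding has_derivative_at_alt by blast
  have "dist (?S t / t\<^sup>2) ?l < e" if t: "0 < t" "t < d / N" for t
  proof -
    define \<psi> where "\<psi> s = f ((w + t *\<^sub>R v) + s *\<^sub>R u) - f (w + s *\<^sub>R u)" for s
    define \<psi>' where "\<psi>' s = u \<bullet> (gradient f ((w + t *\<^sub>R v) + s *\<^sub>R u) - gradient f (w + s *\<^sub>R u))" for s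
    have "(\<psi> has_real_derivative \<psi>' s) (at s)" for s
      unfolding \<psi>_def \<psi>'_def inner_diff_right has_real_derivative_iff_has_vector_derivative
      by (intro has_vector_derivative_diff deriv_along_line gradient_works f)
    then obtain z where z: "0 < z" "z < t" "\<psi> t - \<psi> 0 = (t - 0) * \<psi>' z"
      using MVT2[of 0 t \<psi> \<psi>'] t by blast
    have S: "?S t = t * \<psi>' z"
      using z(3) by (simp add: \<psi>_def algebra_simps)
    define r where "r y = gradient f y - gradient f w - hessian f w *v (y - w)" for y
    define y1 y2 where "y1 = (w + t *\<^sub>R v) + z *\<^sub>R u" and "y2 = w + z *\<^sub>R u"
    have tN: "t * N < d" using t \<open>N > 0\<close> by (simp add: pos_less_divide_eq)
    have "norm (y1 - w) \<le> t * norm v + z * norm u"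
      using norm_triangle_ineq[of "t *\<^sub>R v" "z *\<^sub>R u"] t z by (simp add: y1_def add.assoc)
    also have "\<dots> \<le> t * norm v + t * norm u" using z by (simp add: mult_right_mono)
    finally have n1: "norm (y1 - w) \<le> t * N" using t by (simp add: N_def algebra_simps)
    have "norm (y2 - w) \<le> t * norm u" using z by (simp add: y2_def mult_right_mono)
    also have "\<dots> \<le> t * N" using t by (intro mult_left_mono) (auto simp: N_def)
    finally have n2: "norm (y2 - w) \<le> t * N" .
    have r: "norm (r y) \<le> e' * (t * N)" if "norm (y - w) \<le> t * N" for y
    proof -
      have "norm (r y) \<le> e' * norm (y - w)" unfolding r_def using that tN by (intro d(2)) simp
      also have "\<dots> \<le> e' * (t * N)" using that \<open>e' > 0\<close> by simp
      finally show ?thesis .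
    qed
    have y12: "y1 - w = (y2 - w) + t *\<^sub>R v" by (simp add: y1_def y2_def)
    have "gradient f y1 - gradient f y2 = t *\<^sub>R (hessian f w *v v) + (r y1 - r y2)"
      unfolding r_def y12 by (simp add: matrix_vector_right_distrib matrix_vector_mult_scaleR)
    then have "\<psi>' z - t * ?l = u \<bullet> (r y1 - r y2)"
      by (simp add: \<psi>'_def y1_def[symmetric] y2_def[symmetric] inner_add_right)
    then have "\<bar>\<psi>' z - t * ?l\<bar> \<le> norm u * norm (r y1 - r y2)"
      using Cauchy_Schwarz_ineq2[of u "r y1 - r y2"] by simp
    also have "\<dots> \<le> N * (e' * (t * N) + e' * (t * N))"
      using r[OF n1] r[OF n2] norm_triangle_ineq4[of "r y1" "r y2"]
      by (intro mult_mono) (auto simp: N_def)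
    also have "\<dots> = t * (e / 2)" using \<open>N > 0\<close> by (simp add: e'_def)
    also have "\<dots> < t * e" using t \<open>e > 0\<close> by simp
    finally have "\<bar>\<psi>' z - t * ?l\<bar> < t * e" .
    moreover have "?S t / t\<^sup>2 - ?l = (\<psi>' z - t * ?l) / t"
      unfolding S using t by (simp add: field_simps power2_eq_square)
    ultimately show ?thesis
      using t by (simp add: dist_real_def abs_divide pos_divide_less_eq mult.commute)
  qed
  moreover have "d / N > 0" using d \<open>N > 0\<close> by simp
  ultimately show "\<forall>\<^sub>F t in at_right 0. dist (?S t / t\<^sup>2) ?l < e"
    unfolding eventually_at_right_field by (intro exI[of _ "d / N"]) auto
qed

text \<open>The second difference is symmetric in the two directions, and limits are unique.\<close>

lemma hessian_symmetric:
  fixes f :: "real ^ 'n \<Rightarrow> real"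
  assumes "twice_differentiable f"
  shows "u \<bullet> (hessian f w *v v) = (hessian f w *v u) \<bullet> v"
proof -
  have f: "\<And>w. f differentiable (at w)" "gradient f differentiable (at w)"
    using assms by (auto simp: twice_differentiable_def)
  have eq: "(\<lambda>t. (f (w + t *\<^sub>R v + t *\<^sub>R u) - f (w + t *\<^sub>R v) - f (w + t *\<^sub>R u) + f w) / t\<^sup>2)
    = (\<lambda>t. (f (w + t *\<^sub>R u + t *\<^sub>R v) - f (w + t *\<^sub>R u) - f (w + t *\<^sub>R v) + f w) / t\<^sup>2)"
    by (simp add: algebra_simps)
  have "u \<bullet> (hessian f w *v v) = v \<bullet> (hessian f w *v u)"
    by (rule tendsto_unique[OF _ second_difference_tendsto[OF f, of u v]
          second_difference_tendsto[OF f, of v u, unfolded eq]]) simp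
  then show ?thesis by (simp add: inner_commute)
qed

subsection \<open>The functions \<open>\<omega>\<close> and \<open>\<omega>\<^sub>*\<close>\<close>

text \<open>The conjugate \<open>\<omega>\<^sub>*(t) = -t - log(1 - t)\<close> of \<open>\<omega>\<close> is \<open>omega (-t)\<close>.\<close>

lemma DERIV_omega: "1 + c * t > 0 \<Longrightarrow> ((\<lambda>t. omega (c * t)) has_real_derivative (c - c / (1 + c * t))) (at t)"
  unfolding omega_def by (auto intro!: derivative_eq_intros)

lemma DERIV_omega': "1 + c * t > 0 \<Longrightarrow> ((\<lambda>t. c - c / (1 + c * t)) has_real_derivative (c\<^sup>2 / (1 + c * t)\<^sup>2)) (at t)"
  by (auto intro!: derivative_eq_intros simp: power2_eq_square)

lemma omega_0 [simp]: "omega 0 = 0"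
  by (simp add: omega_def)

lemma omega_mono:
  assumes "0 \<le> x" "x \<le> y" shows "omega x \<le> omega y"
proof (rule DERIV_nonneg_imp_nondecreasing[OF assms(2), of omega])
  fix t assume "x \<le> t" "t \<le> y"
  then have "0 \<le> t" using assms by simp
  then show "\<exists>d. (omega has_real_derivative d) (at t) \<and> 0 \<le> d"
    using DERIV_omega[of 1 t] by (intro exI[of _ "1 - 1 / (1 + t)"]) auto
qed

lemma omega_ge_cubic:
  assumes "0 \<le> x" shows "x\<^sup>2 / 2 - x ^ 3 / 3 \<le> omega x"
proof -
  let ?h = "\<lambda>x. omega x - (x\<^sup>2 / 2 - x ^ 3 / 3)"
  have "?h 0 \<le> ?h x"
  proof (rule DERIV_nonneg_imp_nondecreasing[OF assms, of ?h])
    fix t :: real assume t: "0 \<le> t"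
    have "(?h has_real_derivative (1 - 1 / (1 + t)) - (t - t\<^sup>2)) (at t)"
      using DERIV_omega[of 1 t] t by (auto intro!: derivative_eq_intros simp: power2_eq_square)
    moreover have "(1 - 1 / (1 + t)) - (t - t\<^sup>2) = t ^ 3 / (1 + t)"
      using t by (simp add: divide_simps) (simp add: power2_eq_square power3_eq_cube algebra_simps)
    ultimately show "\<exists>d. (?h has_real_derivative d) (at t) \<and> 0 \<le> d" using t by auto
  qed
  then show ?thesis by simp
qed

lemma omega_le_square:
  assumes "0 \<le> x" shows "omega x \<le> x\<^sup>2 / 2"
proof -
  let ?h = "\<lambda>x. x\<^sup>2 / 2 - omega x"
  have "?h 0 \<le> ?h x"
  proof (rule DERIV_nonneg_imp_nondecreasing[OF assms, of ?h])
    fix t :: real assume t: "0 \<le> t"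
    have "(?h has_real_derivative t - (1 - 1 / (1 + t))) (at t)"
      using DERIV_omega[of 1 t] t by (auto intro!: derivative_eq_intros)
    moreover have "t - (1 - 1 / (1 + t)) = t\<^sup>2 / (1 + t)"
      using t by (simp add: divide_simps) (simp add: power2_eq_square algebra_simps)
    ultimately show "\<exists>d. (?h has_real_derivative d) (at t) \<and> 0 \<le> d" using t by auto
  qed
  then show ?thesis by simp
qed

text \<open>The coefficient 2/5 exceeds the Taylor coefficient 1/3 just enough: the derivative of
  the difference changes sign exactly at 1/6.\<close>

lemma omega_neg_le_cubic:
  assumes "0 \<le> x" "x \<le> 1 / 6" shows "omega (- x) \<le> x\<^sup>2 / 2 + 2 * x ^ 3 / 5"
proof -
  let ?h = "\<lambda>x. (x\<^sup>2 / 2 + 2 * x ^ 3 / 5) - omega (- x)"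
  have "?h 0 \<le> ?h x"
  proof (rule DERIV_nonneg_imp_nondecreasing[OF assms(1), of ?h])
    fix t :: real assume t: "0 \<le> t" "t \<le> x"
    have "(?h has_real_derivative (t + 6 * t\<^sup>2 / 5) - (- 1 - (- 1) / (1 - t))) (at t)"
      using DERIV_omega[of "-1" t] t assms by (auto intro!: derivative_eq_intros simp: power2_eq_square)
    moreover have "(t + 6 * t\<^sup>2 / 5) - (- 1 - (- 1) / (1 - t)) = t\<^sup>2 * (1 - 6 * t) / (5 * (1 - t))"
      using t assms by (simp add: divide_simps) (simp add: power2_eq_square algebra_simps)
    ultimately show "\<exists>d. (?h has_real_derivative d) (at t) \<and> 0 \<le> d" using t assms by auto
  qed
  then show ?thesis by simp
qed

text \<open>The Fenchel-Young inequality for \<open>omega\<close> and its conjugate; it amounts to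
  \<open>ln y \<le> y - 1\<close> at \<open>y = (1 + r) (1 - n)\<close>.\<close>

lemma omega_Young:
  assumes "0 \<le> r" "n < 1" shows "n * r \<le> omega r + omega (- n)"
proof -
  have "ln ((1 + r) * (1 - n)) \<le> (1 + r) * (1 - n) - 1"
    using assms by (intro ln_le_minus_one) simp
  moreover have "ln ((1 + r) * (1 - n)) = ln (1 + r) + ln (1 - n)"
    using assms by (simp add: ln_mult)
  ultimately show ?thesis by (simp add: omega_def algebra_simps)
qed

subsection \<open>Self-concordance along a line\<close>

lemma nonneg_of_second_deriv_nonneg:
  fixes k :: "real \<Rightarrow> real"
  assumes k: "\<And>t. 0 \<le> t \<Longrightarrow> t \<le> 1 \<Longrightarrow> (k has_real_derivative k' t) (at t)"
    and k': "\<And>t. 0 \<le> t \<Longrightarrow> t \<le> 1 \<Longrightarrow> (k' has_real_derivative k'' t) (at t)"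
    and pos: "\<And>t. 0 \<le> t \<Longrightarrow> t \<le> 1 \<Longrightarrow> 0 \<le> k'' t"
    and "k 0 = 0" "k' 0 = 0"
  shows "0 \<le> k 1"
proof -
  have "k' 0 \<le> k' t" if "0 \<le> t" "t \<le> 1" for t
    by (rule DERIV_nonneg_imp_nondecreasing[OF that(1), of k']) (use k' pos that in force)
  then have "k 0 \<le> k 1"
    by (intro DERIV_nonneg_imp_nondecreasing[of 0 1 k]) (use k \<open>k' 0 = 0\<close> in force)+
  then show ?thesis using \<open>k 0 = 0\<close> by simp
qed

text \<open>The inequality \<open>\<bar>a'\<bar> \<le> 2 a\<^bsup>3/2\<^esup>\<close> says that \<open>1 / sqrt a\<close> has Lipschitz constant 1.\<close>

lemma inverse_sqrt_Lipschitz: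
  fixes a a' :: "real \<Rightarrow> real"
  assumes a: "\<And>t. (a has_real_derivative a' t) (at t)"
    and pos: "\<And>t. 0 < a t"
    and sc: "\<And>t. \<bar>a' t\<bar> \<le> 2 * a t powr (3 / 2)"
    and t: "0 \<le> t"
  shows "\<bar>1 / sqrt (a t) - 1 / sqrt (a 0)\<bar> \<le> t"
proof -
  define b' where "b' t = - (a' t / (2 * a t * sqrt (a t)))" for t
  have b: "((\<lambda>t. 1 / sqrt (a t)) has_real_derivative b' t) (at t)" for t
    using pos[of t] by (auto intro!: derivative_eq_intros a simp: b'_def field_simps)
  have b': "\<bar>b' t\<bar> \<le> 1" for t
  proof -
    have "a t powr (3 / 2) = a t powr (1 + 1 / 2)" by simp
    also have "\<dots> = a t * sqrt (a t)" using pos[of t] by (simp only: powr_add powr_half_sqrt) simp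
    finally have "\<bar>a' t\<bar> \<le> 2 * a t * sqrt (a t)" using sc[of t] by simp
    then show ?thesis using pos[of t] by (simp add: b'_def abs_divide abs_mult)
  qed
  show ?thesis
  proof (cases "t = 0")
    case False
    then obtain z where "1 / sqrt (a t) - 1 / sqrt (a 0) = (t - 0) * b' z"
      using MVT2[of 0 t "\<lambda>t. 1 / sqrt (a t)" b'] b t by auto
    then show ?thesis using b'[of z] t by (simp add: abs_mult mult_left_le)
  qed simp
qed

text \<open>The Lipschitz bound traps \<open>a t\<close> between the second derivatives of
  \<open>omega (r * t)\<close> and \<open>omega (- r * t)\<close>; comparing twice from 0 to 1 gives
  the two estimates.\<close>

lemma self_concordant_line:
  fixes p p' a a' :: "real \<Rightarrow> real"
  assumes p: "\<And>t. (p has_real_derivative p' t) (at t)"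
    and p': "\<And>t. (p' has_real_derivative a t) (at t)"
    and a: "\<And>t. (a has_real_derivative a' t) (at t)"
    and pos: "\<And>t. 0 < a t"
    and sc: "\<And>t. \<bar>a' t\<bar> \<le> 2 * a t powr (3 / 2)"
  defines "r \<equiv> sqrt (a 0)"
  shows "p 0 + p' 0 + omega r \<le> p 1"
    and "r < 1 \<Longrightarrow> p 1 \<le> p 0 + p' 0 + omega (- r)"
proof -
  have "r > 0" using pos by (simp add: r_def)
  have sq: "(sqrt (a t))\<^sup>2 = a t" "sqrt (a t) > 0" for t using pos[of t] by simp_all
  have Lip: "\<bar>1 / sqrt (a t) - 1 / r\<bar> \<le> t" if "0 \<le> t" for t
    unfolding r_def by (rule inverse_sqrt_Lipschitz[OF a pos sc that])
  have low: "r\<^sup>2 / (1 + r * t)\<^sup>2 \<le> a t" if "0 \<le> t" for t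
  proof -
    have "1 / sqrt (a t) \<le> (1 + r * t) / r"
      using Lip[OF that] \<open>r > 0\<close> by (simp add: add_divide_distrib)
    then have "r / (1 + r * t) \<le> sqrt (a t)"
      using \<open>r > 0\<close> sq(2)[of t] that by (simp add: field_simps add_pos_nonneg)
    then have "(r / (1 + r * t))\<^sup>2 \<le> (sqrt (a t))\<^sup>2"
      using \<open>r > 0\<close> that by (intro power_mono) auto
    then show ?thesis by (simp add: sq power_divide)
  qed
  have d: "((\<lambda>t. p t - p 0 - p' 0 * t - omega (c * t)) has_real_derivative
        p' t - p' 0 - (c - c / (1 + c * t))) (at t)"
      "((\<lambda>t. p' t - p' 0 - (c - c / (1 + c * t))) has_real_derivative a t - c\<^sup>2 / (1 + c * t)\<^sup>2) (at t)"
    if "1 + c * t > 0" for c t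
    using that by (auto intro!: derivative_eq_intros p p' DERIV_omega DERIV_omega' simp: power2_eq_square)
  have "0 \<le> p 1 - p 0 - p' 0 * 1 - omega (r * 1)"
    by (rule nonneg_of_second_deriv_nonneg[OF d(1) d(2)]) (use \<open>r > 0\<close> low in \<open>auto simp: add_pos_nonneg\<close>)
  then show "p 0 + p' 0 + omega r \<le> p 1" by simp
  show "p 1 \<le> p 0 + p' 0 + omega (- r)" if "r < 1"
  proof -
    have rt: "0 < 1 - r * t" if "0 \<le> t" "t \<le> 1" for t
    proof -
      have "r * t \<le> r" using that \<open>r > 0\<close> by (simp add: mult_left_le)
      then show ?thesis using \<open>r < 1\<close> by simp
    qed
    have upp: "a t \<le> r\<^sup>2 / (1 - r * t)\<^sup>2" if "0 \<le> t" "t \<le> 1" for t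
    proof -
      have "(1 - r * t) / r \<le> 1 / sqrt (a t)"
        using Lip[OF that(1)] \<open>r > 0\<close> by (simp add: diff_divide_distrib)
      then have "sqrt (a t) \<le> r / (1 - r * t)"
        using \<open>r > 0\<close> sq(2)[of t] rt[OF that] by (simp add: field_simps)
      then have "(sqrt (a t))\<^sup>2 \<le> (r / (1 - r * t))\<^sup>2"
        using sq(2)[of t] by (intro power_mono) auto
      then show ?thesis by (simp add: sq power_divide)
    qed
    have "0 \<le> - (p 1 - p 0 - p' 0 * 1 - omega (- r * 1))"
      by (rule nonneg_of_second_deriv_nonneg[OF DERIV_minus[OF d(1)] DERIV_minus[OF d(2)]])
        (use rt upp in auto)
    then show ?thesis by simp
  qed
qed

subsection \<open>Strongly convex self-concordant functions\<close>

locale self_concordant =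
  fixes F :: "real ^ 'n \<Rightarrow> real" and lam :: real
  assumes sc: "standard_self_concordant F"
    and lam_pos: "0 < lam"
    and lower: "\<And>x. loewner_le (mat lam) (hessian F x)"
begin

lemma mat_mult: "mat c *v x = c *\<^sub>R (x :: real ^ 'n)"
  by (simp add: matrix_scalar_ac vec_eq_iff matrix_vector_mult_def mat_def if_distrib if_distribR cong: if_cong)

lemma H_sym: "x \<bullet> (hessian F w *v y) = (hessian F w *v x) \<bullet> y"
  using sc hessian_symmetric
  by (auto simp: standard_self_concordant_def thrice_cont_differentiable_def)

lemma H_ge: "lam * (norm x)\<^sup>2 \<le> x \<bullet> (hessian F w *v x)"
proof -
  have "0 \<le> x \<bullet> ((hessian F w - mat lam) *v x)"
    using lower[of w] by (auto simp: loewner_le_def psd_def)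
  then show ?thesis
    by (simp add: matrix_vector_mult_diff_rdistrib mat_mult inner_diff_right power2_norm_eq_inner)
qed

lemma H_pos: "x \<noteq> 0 \<Longrightarrow> 0 < x \<bullet> (hessian F w *v x)"
  using H_ge[of x w] lam_pos by (smt (verit) mult_pos_pos zero_less_norm_iff zero_less_power)

lemma H_nonneg: "0 \<le> x \<bullet> (hessian F w *v x)"
  using H_pos[of x w] by (cases "x = 0") auto

text \<open>Restriction to the segment from \<open>x\<close> to \<open>x + h\<close>. The line lemma
  requires strictly positive curvature, so \<open>h = 0\<close> is treated apart.\<close>

lemma self_concordant_bounds:
  fixes x h :: "real ^ 'n"
  defines "r \<equiv> sqrt (h \<bullet> (hessian F x *v h))"
  shows "F x + gradient F x \<bullet> h + omega r \<le> F (x + h)"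
    and "r < 1 \<Longrightarrow> F (x + h) \<le> F x + gradient F x \<bullet> h + omega (- r)"
proof -
  have diff: "F differentiable (at w)" "gradient F differentiable (at w)" "hessian F differentiable (at w)" for w
    using sc by (auto simp: standard_self_concordant_def thrice_cont_differentiable_def twice_differentiable_def)
  define p p' a a' where "p t = F (x + t *\<^sub>R h)" and "p' t = h \<bullet> gradient F (x + t *\<^sub>R h)"
    and "a t = h \<bullet> (hessian F (x + t *\<^sub>R h) *v h)"
    and "a' t = h \<bullet> (third_deriv F (x + t *\<^sub>R h) h *v h)" for t
  have p: "(p has_real_derivative p' t) (at t)" for t
    unfolding p_def p'_def has_real_derivative_iff_has_vector_derivative
    by (intro deriv_along_line gradient_works diff)
  have p': "(p' has_real_derivative a t) (at t)" for t
    unfolding p'_def a_def has_real_derivative_iff_has_vector_derivative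
    by (intro bounded_linear.has_vector_derivative[OF bounded_linear_inner_right]
        deriv_along_line hessian_works diff)
  have "linear (\<lambda>A::real^'n^'n. h \<bullet> (A *v h))"
    by (intro linearI)
      (simp_all add: matrix_vector_mult_add_rdistrib inner_add_right scaleR_matrix_vector_assoc[symmetric])
  then have bl: "bounded_linear (\<lambda>A::real^'n^'n. h \<bullet> (A *v h))" by (simp add: linear_linear)
  have a: "(a has_real_derivative a' t) (at t)" for t
    unfolding a_def a'_def has_real_derivative_iff_has_vector_derivative
    by (rule bounded_linear.has_vector_derivative[OF bl])
      (intro deriv_along_line third_deriv_works diff)
  have sc': "\<bar>a' t\<bar> \<le> 2 * a t powr (3 / 2)" for t
    using sc by (auto simp: a_def a'_def standard_self_concordant_def)
  show "F x + gradient F x \<bullet> h + omega r \<le> F (x + h)"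
    and "r < 1 \<Longrightarrow> F (x + h) \<le> F x + gradient F x \<bullet> h + omega (- r)"
  proof -
    have z: "r = sqrt (a 0)" "p 0 = F x" "p 1 = F (x + h)" "p' 0 = gradient F x \<bullet> h"
      by (simp_all add: r_def a_def p_def p'_def inner_commute)
    have "h \<noteq> 0 \<Longrightarrow> 0 < a t" for t by (simp add: a_def H_pos)
    note L = self_concordant_line[OF p p' a this sc', folded z(1), unfolded z(2-4)]
    show "F x + gradient F x \<bullet> h + omega r \<le> F (x + h)" using L(1)
      by (cases "h = 0") (auto simp: r_def)
    show "r < 1 \<Longrightarrow> F (x + h) \<le> F x + gradient F x \<bullet> h + omega (- r)" using L(2)
      by (cases "h = 0") (auto simp: r_def)
  qed
qed

text \<open>The step has local length \<open>r = d / (1 + d) < 1\<close>, so the upper bound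
  applies. Its linear term \<open>- d^2 / (1 + d)\<close> and
  \<open>omega (- r) = ln (1 + d) - r\<close> add up to \<open>- omega d\<close>.\<close>

lemma damped_step:
  assumes "0 \<le> d" "v \<bullet> (hessian F x *v v) = d\<^sup>2" "gradient F x \<bullet> v = d\<^sup>2"
  shows "F (x - (1 / (1 + d)) *\<^sub>R v) \<le> F x - omega d"
proof -
  define h where "h = (- (1 / (1 + d))) *\<^sub>R v"
  define r where "r = d / (1 + d)"
  have "h \<bullet> (hessian F x *v h) = (- (1 / (1 + d))) * ((- (1 / (1 + d))) * (v \<bullet> (hessian F x *v v)))"
    by (simp only: h_def matrix_vector_mult_scaleR inner_scaleR_left inner_scaleR_right)
  also have "\<dots> = r\<^sup>2" by (simp add: r_def assms(2) power2_eq_square)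
  finally have "h \<bullet> (hessian F x *v h) = r\<^sup>2" .
  then have "sqrt (h \<bullet> (hessian F x *v h)) = r" using assms(1) by (simp add: r_def)
  moreover have "r < 1" using assms(1) by (simp add: r_def)
  ultimately have "F (x + h) \<le> F x + gradient F x \<bullet> h + omega (- r)"
    using self_concordant_bounds(2)[of h x] by simp
  moreover have "gradient F x \<bullet> h = - (d\<^sup>2 / (1 + d))" by (simp add: h_def assms(3))
  moreover have "omega (- r) = ln (1 + d) - r"
  proof -
    have "1 + - r = inverse (1 + d)" using assms(1) by (simp add: r_def field_simps)
    then show ?thesis using assms(1) by (simp add: omega_def ln_inverse)
  qed
  moreover have "d\<^sup>2 / (1 + d) + r = d"
    using assms(1) by (simp add: r_def power2_eq_square add_divide_distrib[symmetric]) (simp add: field_simps)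
  moreover have "x + h = x - (1 / (1 + d)) *\<^sub>R v" by (simp add: h_def)
  ultimately show ?thesis unfolding omega_def by simp
qed

section \<open>The exact Newton decrement and the gap of function values\<close>

definition newton :: "real ^ 'n \<Rightarrow> real ^ 'n" where
  "newton x = matrix_inv (hessian F x) *v gradient F x"

definition decr :: "real ^ 'n \<Rightarrow> real" where
  "decr x = sqrt (newton x \<bullet> (hessian F x *v newton x))"

lemma H_newton: "hessian F x *v newton x = gradient F x"
  unfolding newton_def by (rule pos_def_matrix_inv) (rule H_pos)

lemma decr_nonneg: "0 \<le> decr x"
  by (simp add: decr_def H_nonneg)

lemma decr_square: "(decr x)\<^sup>2 = newton x \<bullet> (hessian F x *v newton x)"
  by (simp add: decr_def H_nonneg)

text \<open>The exact damped Newton step achieves this decrease and cannot go below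
  \<open>m\<close>.\<close>

lemma omega_decr_le_gap:
  assumes "\<And>y. m \<le> F y" shows "omega (decr x) \<le> F x - m"
proof -
  have "F (x - (1 / (1 + decr x)) *\<^sub>R newton x) \<le> F x - omega (decr x)"
    by (rule damped_step) (simp_all add: decr_nonneg decr_square H_newton inner_commute)
  then show ?thesis using assms[of "x - (1 / (1 + decr x)) *\<^sub>R newton x"] by linarith
qed

text \<open>Cauchy-Schwarz in the local inner product bounds the linear term from below by
  \<open>- decr x * r\<close>; Young's inequality then eliminates the distance
  \<open>r\<close>.\<close>

lemma gap_le_omega_neg_decr:
  assumes "decr x < 1" shows "F x - F y \<le> omega (- decr x)"
proof -
  define h where "h = y - x"
  define r where "r = sqrt (h \<bullet> (hessian F x *v h))"
  have r: "r \<ge> 0" "r\<^sup>2 = h \<bullet> (hessian F x *v h)" by (simp_all add: r_def H_nonneg)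
  have "(h \<bullet> (hessian F x *v newton x))\<^sup>2 \<le> r\<^sup>2 * (decr x)\<^sup>2"
    unfolding r(2) decr_square by (rule psd_Cauchy_Schwarz) (use H_sym H_nonneg in auto)
  then have "(h \<bullet> gradient F x)\<^sup>2 \<le> (decr x * r)\<^sup>2"
    by (simp add: H_newton power_mult_distrib mult.commute)
  then have "\<bar>h \<bullet> gradient F x\<bar> \<le> decr x * r"
    using r(1) decr_nonneg[of x] by (metis abs_le_square_iff abs_of_nonneg mult_nonneg_nonneg)
  then have "- (decr x * r) \<le> gradient F x \<bullet> h" by (simp add: inner_commute)
  moreover have "decr x * r \<le> omega r + omega (- decr x)" by (rule omega_Young[OF r(1) assms])
  moreover have "F x + gradient F x \<bullet> h + omega r \<le> F y"
    using self_concordant_bounds(1)[of x h] by (simp add: h_def r_def)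
  ultimately show ?thesis by linarith
qed

end

subsection \<open>Inexact Newton steps\<close>

context self_concordant
begin

text \<open>Cauchy-Schwarz in the Hessian form, applied to \<open>y\<close> and its image
  \<open>z\<close>, after which the upper bound at \<open>z\<close> lets \<open>(norm z)^2\<close>
  cancel.\<close>

lemma norm_H_square_le:
  assumes "loewner_le (hessian F x) (mat L)"
  shows "(norm (hessian F x *v y))\<^sup>2 \<le> L * (y \<bullet> (hessian F x *v y))"
proof -
  define z where "z = hessian F x *v y"
  have "0 \<le> z \<bullet> ((mat L - hessian F x) *v z)"
    using assms by (auto simp: loewner_le_def psd_def)
  then have zz: "z \<bullet> (hessian F x *v z) \<le> L * (norm z)\<^sup>2"
    by (simp add: matrix_vector_mult_diff_rdistrib mat_mult inner_diff_right power2_norm_eq_inner)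
  have "((norm z)\<^sup>2)\<^sup>2 = (z \<bullet> (hessian F x *v y))\<^sup>2"
    by (simp add: z_def power2_norm_eq_inner)
  also have "\<dots> \<le> (z \<bullet> (hessian F x *v z)) * (y \<bullet> (hessian F x *v y))"
    by (rule psd_Cauchy_Schwarz) (use H_sym H_nonneg in auto)
  also have "\<dots> \<le> (L * (norm z)\<^sup>2) * (y \<bullet> (hessian F x *v y))"
    by (intro mult_right_mono zz H_nonneg)
  finally have *: "(norm z)\<^sup>2 * (norm z)\<^sup>2 \<le> (norm z)\<^sup>2 * (L * (y \<bullet> (hessian F x *v y)))"
    by (simp add: power2_eq_square mult_ac)
  show ?thesis
  proof (cases "z = 0")
    case True
    then have "y = 0" using H_pos[of y x] by (auto simp: z_def)
    then show ?thesis by simp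
  next
    case False
    then show ?thesis using mult_left_le_imp_le[OF *] by (simp add: z_def)
  qed
qed

lemma norm_H_square_ge: "lam * (y \<bullet> (hessian F x *v y)) \<le> (norm (hessian F x *v y))\<^sup>2"
proof -
  define z where "z = hessian F x *v y"
  have yz: "y \<bullet> z \<le> norm y * norm z" by (rule norm_cauchy_schwarz)
  have "lam * norm y * norm y \<le> norm z * norm y"
    using H_ge[of y x] yz by (simp add: z_def[symmetric] power2_eq_square mult_ac)
  then have le: "lam * norm y \<le> norm z" by (cases "y = 0") simp_all
  have "lam * (y \<bullet> z) \<le> (lam * norm y) * norm z" using yz lam_pos by simp
  also have "\<dots> \<le> norm z * norm z" by (rule mult_right_mono[OF le]) simp
  finally show ?thesis by (simp add: z_def power2_eq_square)
qed

section \<open>The conjugate gradient solve at a single point\<close>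

context
  fixes f1 :: "real ^ 'n \<Rightarrow> real" and mu L :: real and x :: "real ^ 'n"
  assumes f1: "twice_differentiable f1"
    and upper: "loewner_le (hessian F x) (mat L)"
    and lam_le: "lam \<le> L" and mu: "0 \<le> mu"
    and close: "spectral_norm (hessian f1 x - hessian F x) \<le> mu"
begin

private definition "kap = 1 + 2 * mu / lam"
private definition "P = disco_precond f1 mu x"

private lemma kap_ge: "1 \<le> kap"
  using mu lam_pos by (simp add: kap_def)

text \<open>\<open>P\<close> minus the Hessian of \<open>F\<close> is \<open>D + mu I\<close>, whose
  form lies between 0 and \<open>2 * mu * (norm y)^2\<close>; strong convexity converts the latter
  into the Hessian form.\<close>

private lemma P_bounds:
  shows "y \<bullet> (hessian F x *v y) \<le> y \<bullet> (P *v y)"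
    and "y \<bullet> (P *v y) \<le> kap * (y \<bullet> (hessian F x *v y))"
proof -
  define D where "D = hessian f1 x - hessian F x"
  have "norm (D *v y) \<le> onorm ((*v) D) * norm y"
    by (rule onorm) (rule matrix_vector_mul_bounded_linear)
  also have "\<dots> \<le> mu * norm y"
    using close by (intro mult_right_mono) (simp_all add: spectral_norm_def D_def)
  finally have "norm y * norm (D *v y) \<le> norm y * (mu * norm y)" by (rule mult_left_mono) simp
  then have D: "\<bar>y \<bullet> (D *v y)\<bar> \<le> mu * (norm y)\<^sup>2"
    using Cauchy_Schwarz_ineq2[of y "D *v y"] by (simp add: power2_eq_square mult_ac)
  have P: "y \<bullet> (P *v y) = y \<bullet> (hessian F x *v y) + y \<bullet> (D *v y) + mu * (norm y)\<^sup>2"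
    by (simp add: P_def disco_precond_def D_def matrix_vector_mult_diff_rdistrib
        matrix_vector_mult_add_rdistrib mat_mult inner_diff_right inner_add_right power2_norm_eq_inner)
  show "y \<bullet> (hessian F x *v y) \<le> y \<bullet> (P *v y)" using P D by linarith
  have "2 * mu / lam * (lam * (norm y)\<^sup>2) \<le> 2 * mu / lam * (y \<bullet> (hessian F x *v y))"
    using mu lam_pos by (intro mult_left_mono H_ge) simp
  then show "y \<bullet> (P *v y) \<le> kap * (y \<bullet> (hessian F x *v y))"
    using P D lam_pos by (simp add: kap_def distrib_right)
qed

text \<open>The lower spectral bound \<open>1 / (4 kap)\<close> is weaker than the true \<open>1 / kap\<close>; it is less
  than 1 also for \<open>mu = 0\<close>.\<close>

private definition "s = 1 / (2 * sqrt kap)"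

private lemma s_bounds: "0 < s" "s < 1" "s\<^sup>2 * kap \<le> 1"
proof -
  have "1 \<le> sqrt kap" using kap_ge by simp
  then have "1 < 2 * sqrt kap" by linarith
  then show "0 < s" "s < 1" unfolding s_def by (auto simp only: divide_less_eq_1_pos zero_less_divide_1_iff)
  show "s\<^sup>2 * kap \<le> 1" using kap_ge by (simp add: s_def power_divide power_mult_distrib)
qed

private lemma precond: "preconditioned (hessian F x) P s"
proof
  fix y z :: "real ^ 'n"
  show "y \<bullet> (P *v z) = (P *v y) \<bullet> z"
    using hessian_symmetric[OF f1]
    by (simp add: P_def disco_precond_def matrix_vector_mult_add_rdistrib mat_mult inner_add_left inner_add_right)
  have "s\<^sup>2 * (y \<bullet> (P *v y)) \<le> s\<^sup>2 * (kap * (y \<bullet> (hessian F x *v y)))"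
    by (intro mult_left_mono P_bounds) simp
  also have "\<dots> = (s\<^sup>2 * kap) * (y \<bullet> (hessian F x *v y))" by simp
  also have "\<dots> \<le> y \<bullet> (hessian F x *v y)"
    using mult_right_mono[OF s_bounds(3) H_nonneg] by simp
  finally show "s\<^sup>2 * (y \<bullet> (P *v y)) \<le> y \<bullet> (hessian F x *v y)" .
qed (use H_sym H_pos P_bounds s_bounds in auto)

interpretation pc: preconditioned "hessian F x" P s "gradient F x"
  by (rule precond)

private lemma res_newton: "pc.res t = hessian F x *v (newton x - pc.sol t)"
  by (simp add: pc.res_eq matrix_vector_mult_diff_distrib H_newton)

private lemma beta_pos: "0 < beta"
  by (simp add: beta_def)

text \<open>Since \<open>2 * s = 1 / sqrt kap\<close>, the energy error factor falls to
  \<open>(beta * lam / L)^2\<close>. Passing from energy to residual costs \<open>L\<close>, from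
  gradient to energy \<open>1 / lam\<close>; the product is the square of the tolerance
  factor.\<close>

private lemma residual_le_tol:
  assumes "sqrt kap * ln (2 * L / (beta * lam)) \<le> real t"
  shows "norm (pc.res t) \<le> disco_tol F lam L x"
proof -
  have L: "L > 0" using lam_le lam_pos by simp
  have kp: "0 < sqrt kap" using kap_ge by simp
  have "ln (2 * L / (beta * lam)) \<le> 2 * s * real t"
    using assms kp by (simp add: s_def field_simps)
  then have "exp (- (2 * s * real t)) \<le> exp (- ln (2 * L / (beta * lam)))" by simp
  also have "\<dots> = beta * lam / (2 * L)"
    using L lam_pos beta_pos by (simp add: exp_minus)
  finally have q: "2 * exp (- (2 * s * real t)) \<le> beta * lam / L" using L by (simp add: field_simps)
  define E where "E = pc.ip (newton x - pc.sol t) (newton x - pc.sol t)"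
  have "(norm (pc.res t))\<^sup>2 \<le> L * E"
    unfolding res_newton E_def pc.ip_def by (rule norm_H_square_le[OF upper])
  also have "E \<le> (2 * exp (- (2 * s * real t)))\<^sup>2 * pc.ip (newton x) (newton x)"
    unfolding E_def by (rule pc.pcg_energy_bound) (rule H_newton)
  also have "\<dots> \<le> (beta * lam / L)\<^sup>2 * pc.ip (newton x) (newton x)"
    by (intro mult_right_mono power_mono q pc.ip_nonneg) simp
  also have "pc.ip (newton x) (newton x) \<le> (norm (gradient F x))\<^sup>2 / lam"
    using norm_H_square_ge[of "newton x" x] lam_pos by (simp add: pc.ip_def H_newton field_simps)
  finally have "(norm (pc.res t))\<^sup>2 \<le> L * ((beta * lam / L)\<^sup>2 * ((norm (gradient F x))\<^sup>2 / lam))"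
    using L by (simp add: mult_left_mono)
  also have "\<dots> = (disco_tol F lam L x)\<^sup>2"
    using L lam_pos by (simp add: disco_tol_def power_mult_distrib power_divide) (simp add: power2_eq_square)
  finally show ?thesis
  proof (rule power2_le_imp_le)
    show "0 \<le> disco_tol F lam L x" using L lam_pos beta_pos by (simp add: disco_tol_def)
  qed
qed

private lemma log_pos: "0 < sqrt kap * ln (2 * L / (beta * lam))"
proof -
  have "beta * lam \<le> lam" using lam_pos by (simp add: beta_def)
  then have "beta * lam < 2 * L" using lam_le lam_pos by linarith
  then have "1 < 2 * L / (beta * lam)" using lam_pos beta_pos by simp
  then show ?thesis using kap_ge by simp
qed

lemma disco_pcg_halts_within:
  shows "disco_pcg_halts F f1 mu lam L x"
    and "real (disco_pcg_iterations F f1 mu lam L x)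
      \<le> 1 + sqrt (1 + 2 * mu / lam) * ln (2 * L / (beta * lam))"
proof -
  define X where "X = sqrt kap * ln (2 * L / (beta * lam))"
  \<comment> \<open>The stopping test only sees residuals of index at least 1, so the count must be
    a successor; positivity of \<open>X\<close> ensures this.\<close>
  obtain t where t: "nat \<lceil>X\<rceil> = Suc t"
    using log_pos by (cases "nat \<lceil>X\<rceil>") (auto simp: X_def)
  have "norm (pc.res (Suc t)) \<le> disco_tol F lam L x"
    by (rule residual_le_tol) (use t in \<open>simp add: X_def[symmetric]; linarith\<close>)
  then have res: "norm (pcg_residual (hessian F x) P (gradient F x) (Suc t)) \<le> disco_tol F lam L x"
    by (simp add: pc.res_def)
  then show "disco_pcg_halts F f1 mu lam L x"
    unfolding disco_pcg_halts_def pcg_halts_def P_def by blast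
  have "disco_pcg_iterations F f1 mu lam L x \<le> Suc t"
    unfolding disco_pcg_iterations_def pcg_last_def Suc_le_mono
    by (rule Least_le) (use res in \<open>simp add: P_def\<close>)
  also have "real (Suc t) \<le> 1 + X" using t log_pos unfolding X_def by linarith
  finally show "real (disco_pcg_iterations F f1 mu lam L x)
      \<le> 1 + sqrt (1 + 2 * mu / lam) * ln (2 * L / (beta * lam))"
    by (simp add: X_def kap_def)
qed

text \<open>By \<open>pc.energy_sol\<close> the energy \<open>E\<close> of the error is
  \<open>(decr x)^2 - d^2\<close>. Its nonnegativity gives \<open>d \<le> decr x\<close>; the factor
  \<open>sqrt (lam / L)\<close> in the tolerance is what makes \<open>E\<close> at most
  \<open>beta^2\<close> times the squared decrement.\<close>

lemma disco_direction_bounds: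
  fixes d v
  defines "d \<equiv> disco_decrement F f1 mu lam L x" and "v \<equiv> disco_direction F f1 mu lam L x"
  shows "0 \<le> d" "v \<bullet> (hessian F x *v v) = d\<^sup>2" "gradient F x \<bullet> v = d\<^sup>2" "d \<le> decr x"
    "(1 - beta\<^sup>2) * (decr x)\<^sup>2 \<le> d\<^sup>2"
proof -
  define t where "t = disco_pcg_iterations F f1 mu lam L x"
  have v: "v = pc.sol t"
    by (simp add: v_def t_def disco_direction_def pc.sol_def flip: P_def)
  have d: "d = sqrt (v \<bullet> (hessian F x *v v))"
    by (simp add: d_def v_def disco_decrement_def Let_def)
  then show "0 \<le> d" by (simp add: H_nonneg)
  show d2: "v \<bullet> (hessian F x *v v) = d\<^sup>2" by (simp add: d H_nonneg)
  then show gv: "gradient F x \<bullet> v = d\<^sup>2" using pc.energy_sol[of t] by (simp add: v)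
  define E where "E = (newton x - v) \<bullet> (hessian F x *v (newton x - v))"
  have 1: "newton x \<bullet> (hessian F x *v v) = d\<^sup>2"
    unfolding H_sym H_newton by (rule gv)
  have 2: "v \<bullet> (hessian F x *v newton x) = d\<^sup>2"
    unfolding H_newton inner_commute[of v] by (rule gv)
  have "E = newton x \<bullet> (hessian F x *v newton x) - newton x \<bullet> (hessian F x *v v)
      - (v \<bullet> (hessian F x *v newton x) - v \<bullet> (hessian F x *v v))"
    unfolding E_def matrix_vector_mult_diff_distrib inner_diff_left inner_diff_right by simp
  then have E: "E = (decr x)\<^sup>2 - d\<^sup>2"
    unfolding 1 2 d2 decr_square by simp
  have "0 \<le> E" by (simp add: E_def H_nonneg)
  then show "d \<le> decr x"
    by (intro power2_le_imp_le[OF _ decr_nonneg]) (simp add: E)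
  have L: "L > 0" using lam_le lam_pos by simp
  have "\<exists>t. norm (pc.res (Suc t)) \<le> disco_tol F lam L x"
    using disco_pcg_halts_within(1) by (simp add: disco_pcg_halts_def pcg_halts_def pc.res_def flip: P_def)
  then have "norm (pc.res (Suc (LEAST t. norm (pc.res (Suc t)) \<le> disco_tol F lam L x))) \<le> disco_tol F lam L x"
    by (rule LeastI_ex[of "\<lambda>t. norm (pc.res (Suc t)) \<le> disco_tol F lam L x"])
  moreover have "t = Suc (LEAST t. norm (pc.res (Suc t)) \<le> disco_tol F lam L x)"
    by (simp add: t_def disco_pcg_iterations_def pcg_last_def pc.res_def flip: P_def)
  ultimately have "norm (pc.res t) \<le> disco_tol F lam L x" by simp
  then have "(norm (pc.res t))\<^sup>2 \<le> (disco_tol F lam L x)\<^sup>2" by (intro power_mono) auto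
  also have "\<dots> = beta\<^sup>2 * (lam / L) * (norm (gradient F x))\<^sup>2"
    using L lam_pos by (simp add: disco_tol_def power_mult_distrib)
  also have "\<dots> \<le> beta\<^sup>2 * (lam / L) * (L * (decr x)\<^sup>2)"
    using norm_H_square_le[OF upper, of "newton x"] L lam_pos
    by (intro mult_left_mono) (simp_all add: H_newton decr_square)
  also have "\<dots> = lam * (beta\<^sup>2 * (decr x)\<^sup>2)" using L by simp
  finally have "(norm (pc.res t))\<^sup>2 \<le> lam * (beta\<^sup>2 * (decr x)\<^sup>2)" .
  moreover have "lam * E \<le> (norm (pc.res t))\<^sup>2"
    unfolding E_def v res_newton by (rule norm_H_square_ge)
  ultimately have "E \<le> beta\<^sup>2 * (decr x)\<^sup>2" using lam_pos by (smt (verit) mult_le_cancel_left_pos)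
  then show "(1 - beta\<^sup>2) * (decr x)\<^sup>2 \<le> d\<^sup>2" by (simp add: E algebra_simps)
qed

lemma disco_step_decrease:
  "F (disco_step F f1 mu lam L x) \<le> F x - omega (disco_decrement F f1 mu lam L x)"
  unfolding disco_step_def by (rule damped_step) (rule disco_direction_bounds)+

end

end

subsection \<open>Counting outer iterations\<close>

lemma real_nceil_ge: "t \<le> real (nceil t)"
  unfolding nceil_def by linarith

lemma real_nceil_le: "0 \<le> t \<Longrightarrow> real (nceil t) \<le> t + 1"
  unfolding nceil_def by linarith

text \<open>The Taylor bounds at 1/6 are 1/81 and 1/72; the first is rounded down.\<close>

lemma omega_sixth: "123 / 10000 \<le> omega (1 / 6)" "omega (1 / 6) \<le> 1 / 72"
  using omega_ge_cubic[of "1 / 6"] omega_le_square[of "1 / 6"] by (simp_all add: power2_eq_square power3_eq_cube)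

text \<open>\<open>D\<close> is the gap of the function values, \<open>n\<close> the exact and \<open>d\<close> the approximate Newton
  decrement.\<close>

locale newton_decrements =
  fixes D n d :: "nat \<Rightarrow> real"
  assumes D_nonneg: "0 \<le> D k"
    and omega_le_D: "omega (n k) \<le> D k"
    and D_le_omega: "n k < 1 \<Longrightarrow> D k \<le> omega (- n k)"
    and D_Suc: "D (Suc k) \<le> D k - omega (d k)"
    and d_nonneg: "0 \<le> d k" and d_le_n: "d k \<le> n k"
    and d_ge_n: "(1 - beta\<^sup>2) * (n k)\<^sup>2 \<le> (d k)\<^sup>2"
begin

lemma n_nonneg: "0 \<le> n k"
  using d_nonneg[of k] d_le_n[of k] by simp

lemma omega_d_nonneg: "0 \<le> omega (d k)"
  using omega_mono[of 0 "d k"] d_nonneg by simp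

lemma D_decreasing: "D (Suc k) \<le> D k"
  using D_Suc[of k] omega_d_nonneg[of k] by simp

text \<open>Losing the factor \<open>1 - beta^2\<close> still leaves \<open>d k\<close> at least
  0.16, and \<open>omega\<close> there is at least 1/100, above \<open>1 / 144\<close>.\<close>

lemma damped_phase:
  assumes "1 / 6 < n k" shows "D (Suc k) \<le> D k - 1 / 2 * omega (1 / 6)"
proof -
  have "(16 / 100)\<^sup>2 \<le> (1 - beta\<^sup>2) * (1 / 6)\<^sup>2" by (simp add: beta_def power2_eq_square)
  also have "\<dots> \<le> (1 - beta\<^sup>2) * (n k)\<^sup>2"
    using assms by (intro mult_left_mono power_mono) (simp_all add: beta_def power2_eq_square)
  also have "\<dots> \<le> (d k)\<^sup>2" by (rule d_ge_n)
  finally have "16 / 100 \<le> d k" using d_nonneg by (rule power2_le_imp_le)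
  then have "omega (16 / 100) \<le> omega (d k)" by (intro omega_mono) auto
  moreover have "1 / 100 \<le> omega (16 / 100)"
    using omega_ge_cubic[of "16 / 100"] by (simp add: power2_eq_square power3_eq_cube)
  ultimately show ?thesis using D_Suc[of k] omega_sixth by linarith
qed

lemma D_le_square:
  assumes "n k \<le> 1 / 6" shows "D k \<le> 17 / 30 * (n k)\<^sup>2"
proof -
  have "(n k)\<^sup>2 * n k \<le> (n k)\<^sup>2 * (1 / 6)" using assms by (intro mult_left_mono) auto
  then show ?thesis
    using D_le_omega[of k] omega_neg_le_cubic[OF n_nonneg assms] assms
    by (simp add: power3_eq_cube power2_eq_square)
qed

text \<open>With cubic terms absorbed by \<open>n k \<le> 1 / 6\<close>, the bounds on
  \<open>omega (d k)\<close> and \<open>D k\<close> compare as multiples of \<open>(n k)^2\<close>.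
  The smaller gap then cannot reach \<open>omega (1 / 6)\<close>, which keeps the decrement below
  1/6.\<close>

lemma quadratic_phase:
  assumes "n k \<le> 1 / 6" shows "D (Suc k) \<le> 1 / 4 * D k" "n (Suc k) \<le> 1 / 6"
proof -
  have b: "1 - beta\<^sup>2 = 399 / 400" by (simp add: beta_def power2_eq_square)
  have "d k ^ 3 \<le> n k ^ 3" using d_nonneg d_le_n by (intro power_mono)
  then have low: "(1 - beta\<^sup>2) * (n k)\<^sup>2 / 2 - n k ^ 3 / 3 \<le> omega (d k)"
    using omega_ge_cubic[OF d_nonneg, of k] d_ge_n[of k] by linarith
  have cub: "n k ^ 3 \<le> 1 / 6 * (n k)\<^sup>2"
    using mult_left_mono[OF assms, of "(n k)\<^sup>2"] by (simp add: power3_eq_cube power2_eq_square)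
  have "D k \<le> (n k)\<^sup>2 / 2 + 2 * n k ^ 3 / 5"
    using D_le_omega[of k] omega_neg_le_cubic[OF n_nonneg assms] assms by simp
  then have "3 / 4 * D k \<le> omega (d k)"
    using low cub zero_le_power2[of "n k"] unfolding b by linarith
  then show D: "D (Suc k) \<le> 1 / 4 * D k" using D_Suc[of k] by linarith
  show "n (Suc k) \<le> 1 / 6"
  proof (rule ccontr)
    assume "\<not> n (Suc k) \<le> 1 / 6"
    then have "omega (1 / 6) \<le> omega (n (Suc k))" by (intro omega_mono) auto
    also have "\<dots> \<le> 1 / 4 * D k" using omega_le_D[of "Suc k"] D by linarith
    also have "\<dots> \<le> 17 / 120 * (1 / 6)\<^sup>2"
      using D_le_square[OF assms] power_mono[OF assms n_nonneg, of 2] by simp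
    finally show False using omega_sixth by (simp add: power2_eq_square)
  qed
qed

lemma quadratic_phase_iterate:
  assumes "n k \<le> 1 / 6" shows "n (k + j) \<le> 1 / 6 \<and> D (k + j) \<le> (1 / 4) ^ j * D k"
proof (induction j)
  case (Suc j)
  then show ?case using quadratic_phase[of "k + j"] by auto
qed (use assms in simp)

text \<open>\<open>N\<close> damped steps use up the initial gap. The strict \<open>k < N\<close>
  reserves one iteration for the step taken after the stopping test passes; the alternative covers
  exact exhaustion.\<close>

lemma reaches_quadratic_phase:
  defines "N \<equiv> nceil (D 0 / (1 / 2 * omega (1 / 6)))"
  shows "(\<exists>k<N. n k \<le> 1 / 6) \<or> D N = 0"
proof (cases "\<exists>k<N. n k \<le> 1 / 6")
  case False
  have "D j \<le> D 0 - real j * (1 / 2 * omega (1 / 6))" if "j \<le> N" for j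
    using that
  proof (induction j)
    case (Suc j)
    then have "1 / 6 < n j" using False by (meson Suc_le_eq not_le)
    then show ?case using damped_phase[of j] Suc by (simp add: algebra_simps add_divide_distrib)
  qed simp
  from this[of N] have "D N \<le> D 0 - real N * (1 / 2 * omega (1 / 6))" by simp
  moreover have "D 0 \<le> real N * (1 / 2 * omega (1 / 6))"
    using real_nceil_ge[of "D 0 / (1 / 2 * omega (1 / 6))"] omega_sixth(1)
    by (simp add: N_def pos_divide_le_eq)
  ultimately show ?thesis using D_nonneg[of N] by simp
qed simp

lemma n_square_le:
  assumes "n k \<le> 1 / 6" shows "4 / 9 * (n k)\<^sup>2 \<le> D k"
proof -
  have "(n k)\<^sup>2 * n k \<le> (n k)\<^sup>2 * (1 / 6)" using assms by (intro mult_left_mono) auto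
  then show ?thesis
    using omega_le_D[of k] omega_ge_cubic[OF n_nonneg, of k]
    by (simp add: power3_eq_cube power2_eq_square)
qed

text \<open>The test yields \<open>(n k)^2 \<le> eps\<close>, and the bound on \<open>eps\<close>
  makes this at most 1/36. So the point lies in the quadratic regime, where the gap is at most
  \<open>17 / 30 * eps\<close>.\<close>

lemma small_decrement_imp_gap:
  assumes eps: "0 < eps" "eps < 2 * omega (1 / 6)" and d: "d k \<le> (1 - beta) * sqrt eps"
  shows "D k < eps"
proof -
  have "(d k)\<^sup>2 \<le> ((1 - beta) * sqrt eps)\<^sup>2" using d d_nonneg by (intro power_mono)
  then have "(1 - beta\<^sup>2) * (n k)\<^sup>2 \<le> (1 - beta)\<^sup>2 * eps"
    using d_ge_n[of k] eps by (simp add: power_mult_distrib)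
  then have n: "(n k)\<^sup>2 \<le> eps" using eps by (simp add: beta_def power2_eq_square)
  also have "eps \<le> (1 / 6)\<^sup>2" using eps omega_sixth by (simp add: power2_eq_square)
  finally have "n k \<le> 1 / 6" by (rule power2_le_imp_le) simp
  then show ?thesis using D_le_square[of k] n eps by simp
qed

lemma decrement_small:
  assumes eps: "0 < eps" "eps < 2 * omega (1 / 6)"
  shows "\<exists>k < nceil (D 0 / (1 / 2 * omega (1 / 6))) + nceil (log 2 (2 * omega (1 / 6) / eps)).
    d k \<le> (1 - beta) * sqrt eps"
proof -
  define N1 where "N1 = nceil (D 0 / (1 / 2 * omega (1 / 6)))"
  define y where "y = 2 * omega (1 / 6) / eps"
  define N2 where "N2 = nceil (log 2 y)"
  have y: "1 < y" using eps by (simp add: y_def)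
  then have "0 < log 2 y" by simp
  then have N2: "1 \<le> N2" using real_nceil_ge[of "log 2 y"] by (simp add: N2_def)
  \<comment> \<open>A gap of \<open>eps / 3\<close> gives \<open>(d k)^2\<close> at most
    \<open>3 / 4 * eps\<close>, below the squared threshold \<open>0.9025 * eps\<close>.\<close>
  have suff: "d k \<le> (1 - beta) * sqrt eps" if "n k \<le> 1 / 6" "D k \<le> 1 / 3 * eps" for k
  proof (rule power2_le_imp_le)
    have "(d k)\<^sup>2 \<le> (n k)\<^sup>2" using d_nonneg d_le_n by (intro power_mono)
    also have "\<dots> \<le> 9 / 4 * (1 / 3 * eps)" using n_square_le[OF that(1)] that(2) by simp
    also have "\<dots> \<le> ((1 - beta) * sqrt eps)\<^sup>2"
      using eps by (simp add: power_mult_distrib beta_def power2_eq_square)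
    finally show "(d k)\<^sup>2 \<le> ((1 - beta) * sqrt eps)\<^sup>2" .
    show "0 \<le> (1 - beta) * sqrt eps" using eps by (simp add: beta_def)
  qed
  have "\<exists>k<N1 + N2. d k \<le> (1 - beta) * sqrt eps"
    using reaches_quadratic_phase[folded N1_def]
  proof (elim disjE exE conjE)
    fix k assume k: "k < N1" "n k \<le> 1 / 6"
    have "y = 2 powr (log 2 y)" using y by simp
    also have "\<dots> \<le> 2 powr real N2" unfolding N2_def by (intro powr_mono real_nceil_ge) simp
    finally have "y \<le> 2 ^ N2" by (simp add: powr_realpow)
    \<comment> \<open>The contraction is by 1/4 while \<open>N2\<close> counts halvings; as
      \<open>N2\<close> is at least 1, this yields an extra factor 2.\<close>
    moreover have "(2::real) * 2 ^ N2 \<le> 2 ^ N2 * 2 ^ N2"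
      using power_increasing[OF N2, of "2::real"] by simp
    ultimately have "2 * y \<le> 4 ^ N2" by (simp add: power_mult_distrib[symmetric])
    then have q: "(1 / 4) ^ N2 \<le> 1 / (2 * y)" using y by (simp add: power_divide field_simps)
    have Dk: "D k \<le> 17 / 30 * (1 / 6)\<^sup>2"
      using D_le_square[OF k(2)] power_mono[OF k(2) n_nonneg, of 2] by simp
    have "D (k + N2) \<le> (1 / 4) ^ N2 * D k" using quadratic_phase_iterate[OF k(2)] by simp
    also have "\<dots> \<le> 1 / (2 * y) * (17 / 30 * (1 / 6)\<^sup>2)"
      using q Dk y D_nonneg by (intro mult_mono) auto
    also have "\<dots> = eps * (17 / 4320 / omega (1 / 6))"
      using eps omega_sixth by (simp add: y_def power2_eq_square)
    also have "\<dots> \<le> eps * (1 / 3)"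
      using eps omega_sixth(1) by (intro mult_left_mono) (simp_all add: pos_divide_le_eq)
    finally have "D (k + N2) \<le> 1 / 3 * eps" by simp
    then have "d (k + N2) \<le> (1 - beta) * sqrt eps"
      using quadratic_phase_iterate[OF k(2), of N2] by (intro suff) auto
    then show ?thesis using k(1) by (intro exI[of _ "k + N2"]) simp
  next
    assume D0: "D N1 = 0"
    have "n N1 \<le> 1 / 6"
    proof (rule ccontr)
      assume "\<not> n N1 \<le> 1 / 6"
      then have "omega (1 / 6) \<le> omega (n N1)" by (intro omega_mono) auto
      then show False using omega_le_D[of N1] D0 omega_sixth by simp
    qed
    then have "d N1 \<le> (1 - beta) * sqrt eps" using D0 eps by (intro suff) auto
    \<comment> \<open>\<open>N2\<close> is at least 1, so \<open>N1\<close> is an admissible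
      index.\<close>
    then show ?thesis using N2 by (intro exI[of _ N1]) simp
  qed
  then show ?thesis by (simp add: N1_def N2_def y_def)
qed

text \<open>For large \<open>eps\<close> the logarithmic term may contribute no iterations, but then
  the gap on entering the quadratic phase, at most 17/1080, is already below
  \<open>eps\<close>.\<close>

lemma gap_small:
  assumes eps: "0 < eps"
  shows "\<exists>K \<le> nceil (D 0 / (1 / 2 * omega (1 / 6))) + nceil (log 2 (2 * omega (1 / 6) / eps)). D K < eps"
proof (cases "eps < 2 * omega (1 / 6)")
  case True
  then show ?thesis
    using decrement_small[OF eps True] small_decrement_imp_gap[OF eps True] less_imp_le by metis
next
  case False
  have "\<exists>K \<le> nceil (D 0 / (1 / 2 * omega (1 / 6))). D K < eps"
    using reaches_quadratic_phase
  proof (elim disjE exE conjE)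
    fix k assume k: "k < nceil (D 0 / (1 / 2 * omega (1 / 6)))" "n k \<le> 1 / 6"
    have "D k \<le> 17 / 30 * (1 / 6)\<^sup>2"
      using D_le_square[OF k(2)] power_mono[OF k(2) n_nonneg, of 2] by simp
    also have "\<dots> < eps" using False omega_sixth by (simp add: power2_eq_square)
    finally show ?thesis using k(1) less_imp_le by blast
  qed (use eps in auto)
  then show ?thesis by (meson trans_le_add1)
qed

end

text \<open>The two ceilings are at most \<open>167 * D + 1\<close> and \<open>2 * E + 1\<close>.
  All additive constants are absorbed using \<open>E \<ge> 1 / 2\<close> and
  \<open>X \<ge> 3\<close>, giving the coefficients 334 and 14, well within 1000.\<close>

lemma round_bound_le:
  assumes D: "0 \<le> D" and eps: "0 < eps" "eps \<le> 1 / 2" and X: "3 \<le> X"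
  shows "1 + (real (nceil (D / (1 / 2 * omega (1 / 6)))) + real (nceil (log 2 (2 * omega (1 / 6) / eps))))
      * (2 + X) \<le> 1000 * ((D + ln (1 / eps)) * X)"
proof -
  define E where "E = ln (1 / eps)"
  have ln2: "1 / 2 \<le> ln (2::real)" using ln2_ge_two_thirds by simp
  have "ln 2 \<le> E" unfolding E_def using eps by (subst ln_le_cancel_iff) (auto simp: field_simps)
  then have E: "1 / 2 \<le> E" using ln2 by simp
  have "D / (1 / 2 * omega (1 / 6)) \<le> D / (6 / 1000)"
    using D omega_sixth(1) by (intro divide_left_mono) auto
  then have "real (nceil (D / (1 / 2 * omega (1 / 6)))) \<le> 167 * D + 1"
    using real_nceil_le[of "D / (1 / 2 * omega (1 / 6))"] D omega_sixth(1) by simp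
  moreover have "real (nceil (log 2 (2 * omega (1 / 6) / eps))) \<le> 2 * E + 1"
  proof -
    have "log 2 (2 * omega (1 / 6) / eps) \<le> log 2 (1 / eps)"
      using omega_sixth eps by (intro log_mono) (auto simp: divide_right_mono)
    also have "\<dots> = E / ln 2" by (simp add: log_def E_def)
    also have "\<dots> \<le> E / (1 / 2)" using E ln2 by (intro divide_left_mono) auto
    finally have "nceil (log 2 (2 * omega (1 / 6) / eps)) \<le> nceil (2 * E)"
      unfolding nceil_def by (intro nat_mono ceiling_mono) simp
    then show ?thesis using real_nceil_le[of "2 * E"] E by linarith
  qed
  ultimately have "real (nceil (D / (1 / 2 * omega (1 / 6)))) + real (nceil (log 2 (2 * omega (1 / 6) / eps)))
      \<le> 167 * D + 6 * E" using E by linarith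
  then have "1 + (real (nceil (D / (1 / 2 * omega (1 / 6)))) + real (nceil (log 2 (2 * omega (1 / 6) / eps))))
      * (2 + X) \<le> 1 + (167 * D + 6 * E) * (2 + X)"
    using X by (simp add: mult_right_mono)
  also have "\<dots> \<le> 2 * E * X + (167 * D + 6 * E) * (2 * X)"
  proof (rule add_mono)
    have "1 / 2 * 3 \<le> E * X" using E X by (intro mult_mono) auto
    then show "1 \<le> 2 * E * X" by simp
    show "(167 * D + 6 * E) * (2 + X) \<le> (167 * D + 6 * E) * (2 * X)"
      using D E X by (intro mult_left_mono) auto
  qed
  also have "\<dots> = 334 * (D * X) + 14 * (E * X)" by (simp add: algebra_simps)
  also have "\<dots> \<le> 1000 * (D * X) + 1000 * (E * X)"
    using D E X by (intro add_mono mult_right_mono) auto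
  finally show ?thesis by (simp add: E_def algebra_simps)
qed

text \<open>Halting of every inner run gives the round counts a meaning. Rounds are counted both up
  to the first accurate iterate and up to the output of the actual stopping rule. In
  \<open>C\<close> the soft O is explicit: the constant is 1000 and the hidden logarithm is
  \<open>ln (2 * L / (beta * lam))\<close>; \<open>eps \<le> 1 / 2\<close> keeps
  \<open>ln (1 / eps)\<close> away from 0.\<close>

theorem theorem2:
  fixes f :: "nat \<Rightarrow> real ^ 'n \<Rightarrow> real" and F :: "real ^ 'n \<Rightarrow> real" and m :: nat
    and what w :: "nat \<Rightarrow> real ^ 'n" and wstar :: "real ^ 'n"
    and rho mu lam L eps B C :: real and T :: "nat \<Rightarrow> nat"
  assumes "m \<ge> 1"
    and "\<And>i. i \<in> {1..m} \<Longrightarrow> convex_on UNIV (f i)"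
    and "\<And>i. i \<in> {1..m} \<Longrightarrow> twice_differentiable (f i)"
    and F: "F = (\<lambda>x. (1 / real m) * (\<Sum>i = 1..m. f i x))"
    and "standard_self_concordant F"
    and "twice_cont_differentiable F"
    and "0 < lam" and "lam \<le> L"
    and "\<And>x. loewner_le (mat lam) (hessian F x)"
    and "\<And>x. loewner_le (hessian F x) (mat L)"
    and "is_arg_min F (\<lambda>_. True) wstar"
    and "rho \<ge> 0" and "mu \<ge> 0"
    and "\<And>i. i \<in> {1..m} \<Longrightarrow>
           is_arg_min (\<lambda>x. f i x + rho / 2 * (norm x)\<^sup>2) (\<lambda>_. True) (what i)"
    and w: "w = disco_iterate F (f 1) mu lam L ((1 / real m) *\<^sub>R (\<Sum>i = 1..m. what i))"
    and "\<And>k. spectral_norm (hessian (f 1) (w k) - hessian F (w k)) \<le> mu"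
    and "eps > 0"
    and T: "T = disco_rounds F (f 1) mu lam L (w 0)"
    and B: "B = 1 + (real (nceil ((F (w 0) - F wstar) / (1 / 2 * omega (1 / 6))))
                     + real (nceil (log 2 (2 * omega (1 / 6) / eps))))
                    * (2 + sqrt (1 + 2 * mu / lam) * ln (2 * L / (beta * lam)))"
    and C: "C = 1000 * ((F (w 0) - F wstar + ln (1 / eps)) * sqrt (1 + 2 * mu / lam)
                        * ln (2 * L / (beta * lam)))"
  shows "(\<forall>k. disco_pcg_halts F (f 1) mu lam L (w k)) \<and>
         (\<exists>K. F (w K) - F wstar < eps \<and> (\<forall>j<K. \<not> F (w j) - F wstar < eps) \<and>
              real (T K) \<le> B \<and> (eps \<le> 1 / 2 \<longrightarrow> real (T K) \<le> C)) \<and>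
         (eps < 2 * omega (1 / 6) \<longrightarrow>
            (\<exists>k. disco_last F (f 1) mu lam L eps (w 0) k \<and> F (w (Suc k)) - F wstar < eps \<and>
                 real (T (Suc k)) \<le> B \<and> real (T (Suc k)) \<le> C))"
proof -
  note f_diff = assms(3) and sc = assms(5) and lam = assms(7,8)
    and lower = assms(9) and upper = assms(10) and min = assms(11) and mu = assms(13)
    and close = assms(16) and eps = assms(17)
  interpret self_concordant F lam
    by unfold_locales (fact sc lam lower)+
  have f1: "twice_differentiable (f 1)" using assms(1) by (intro f_diff) simp
  note pcg = disco_pcg_halts_within[OF f1 upper lam(2) mu close]
    and dir = disco_direction_bounds[OF f1 upper lam(2) mu close]
    and step = disco_step_decrease[OF f1 upper lam(2) mu close]
  define d where "d k = disco_decrement F (f 1) mu lam L (w k)" for k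
  have wstar: "F wstar \<le> F x" for x
    using min by (auto simp: is_arg_min_def not_less)
  have w0: "disco_iterate F (f 1) mu lam L (w 0) = w"
    by (simp add: w)
  have w_Suc: "w (Suc k) = disco_step F (f 1) mu lam L (w k)" for k
    by (simp add: w)
  interpret newton_decrements "\<lambda>k. F (w k) - F wstar" "\<lambda>k. decr (w k)" d
  proof
    fix k
    show "0 \<le> F (w k) - F wstar" using wstar by simp
    show "omega (decr (w k)) \<le> F (w k) - F wstar" using wstar by (rule omega_decr_le_gap)
    show "decr (w k) < 1 \<Longrightarrow> F (w k) - F wstar \<le> omega (- decr (w k))" by (rule gap_le_omega_neg_decr)
    show "F (w (Suc k)) - F wstar \<le> F (w k) - F wstar - omega (d k)"
      using step[of k] by (simp add: w_Suc d_def)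
  qed (use dir in \<open>auto simp: d_def\<close>)
  define N where "N = nceil ((F (w 0) - F wstar) / (1 / 2 * omega (1 / 6)))
    + nceil (log 2 (2 * omega (1 / 6) / eps))"
  define X where "X = sqrt (1 + 2 * mu / lam) * ln (2 * L / (beta * lam))"
  \<comment> \<open>\<open>1 / beta\<close> is 20, so the logarithm has argument at least 40, which
    exceeds \<open>exp 3\<close>.\<close>
  have X: "3 \<le> X"
  proof -
    have "exp 3 = exp (1::real) ^ 3" by (simp flip: exp_of_nat_mult)
    also have "\<dots> \<le> 3 ^ 3" using exp_le by (intro power_mono) auto
    finally have "exp 3 \<le> (40::real)" by simp
    also have "40 \<le> 2 * L / (beta * lam)" using lam by (simp add: beta_def field_simps)
    finally have ln: "3 \<le> ln (2 * L / (beta * lam))"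
      using less_le_trans[OF exp_gt_zero] by (subst ln_ge_iff) blast+
    have "1 \<le> sqrt (1 + 2 * mu / lam)" using mu lam by simp
    then have "1 * 3 \<le> X" unfolding X_def using ln by (intro mult_mono) auto
    then show ?thesis by simp
  qed
  have B': "B = 1 + real N * (2 + X)" by (simp add: B N_def X_def)
  have C': "C = 1000 * ((F (w 0) - F wstar + ln (1 / eps)) * X)" by (simp add: C X_def mult.assoc)
  have TB: "real (T K) \<le> B" if "K \<le> N" for K
  proof -
    \<comment> \<open>Each outer iteration costs one round for the gradient and at most
      \<open>1 + X\<close> for the solve.\<close>
    have "(\<Sum>k<K. 1 + real (disco_pcg_iterations F (f 1) mu lam L (w k))) \<le> real (card {..<K}) * (2 + X)"
      by (rule sum_bounded_above) (use pcg(2) in \<open>simp add: X_def\<close>)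
    then have "real (T K) \<le> 1 + real K * (2 + X)"
      unfolding T disco_rounds_def w0 by simp
    also have "\<dots> \<le> B" unfolding B' using that X by (simp add: mult_right_mono)
    finally show ?thesis .
  qed
  have BC: "B \<le> C" if "eps \<le> 1 / 2"
    using round_bound_le[OF D_nonneg eps that X, of 0] by (simp add: B' C' N_def)
  have "\<exists>K. F (w K) - F wstar < eps \<and> (\<forall>j<K. \<not> F (w j) - F wstar < eps) \<and>
              real (T K) \<le> B \<and> (eps \<le> 1 / 2 \<longrightarrow> real (T K) \<le> C)"
  proof -
    obtain K where K: "K \<le> N" "F (w K) - F wstar < eps"
      using gap_small[OF eps] by (auto simp: N_def)
    define K0 where "K0 = (LEAST K. F (w K) - F wstar < eps)"
    have "F (w K0) - F wstar < eps" unfolding K0_def using K(2) by (rule LeastI)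
    moreover have "K0 \<le> K" unfolding K0_def using K(2) by (rule Least_le)
    moreover have "\<forall>j<K0. \<not> F (w j) - F wstar < eps" unfolding K0_def using not_less_Least by blast
    ultimately show ?thesis using TB[of K0] BC K(1) by (intro exI[of _ K0]) auto
  qed
  moreover have "\<exists>k. disco_last F (f 1) mu lam L eps (w 0) k \<and> F (w (Suc k)) - F wstar < eps \<and>
                 real (T (Suc k)) \<le> B \<and> real (T (Suc k)) \<le> C" if small: "eps < 2 * omega (1 / 6)"
  proof -
    obtain k where k: "k < N" "d k \<le> (1 - beta) * sqrt eps"
      using decrement_small[OF eps small] by (auto simp: N_def)
    define k0 where "k0 = (LEAST k. d k \<le> (1 - beta) * sqrt eps)"
    have k0: "d k0 \<le> (1 - beta) * sqrt eps" unfolding k0_def using k(2) by (rule LeastI)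
    moreover have "k0 \<le> k" unfolding k0_def using k(2) by (rule Least_le)
    moreover have "\<forall>j<k0. \<not> d j \<le> (1 - beta) * sqrt eps" unfolding k0_def using not_less_Least by blast
    \<comment> \<open>The test bounds the gap at \<open>w k0\<close>; the output is the next
      iterate, whose gap is no larger.\<close>
    moreover have "F (w (Suc k0)) - F wstar < eps"
      using small_decrement_imp_gap[OF eps small k0] D_decreasing[of k0] by linarith
    moreover have "eps \<le> 1 / 2" using small omega_sixth by linarith
    ultimately show ?thesis
      unfolding disco_last_def w0 d_def[symmetric]
      using TB[of "Suc k0"] BC k(1) by (intro exI[of _ k0]) auto
  qed
  ultimately show ?thesis using pcg(1) by blast
qed

end
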